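(* Let $c$ be a constant with $c<100\log 2-2$. For every $\varepsilon>0$ there exists an integer $n_0$ with the following property. Let $q(x)\in\mathbb{Z}[x]$. Assume that there is a polynomial $f(x)\in\mathbb{Z}[x]$ with $f(1)\ne 0$ and a positive integer $m$ such that $q(x)$ divides $(x^m-1)f(x)$. Let $n=\deg\big((x^m-1)f(x)\big)$ and assume $n\ge n_0$. If $\|f(x)\|\le n^c$ and there exists a positive integer $k$ such that $q(x)$ divides $l(x^k-1)$ for some integer $l$, then for the smallest such $k$ we have \[\log k\le n^{\frac13+\varepsilon}.\]
   Context: For $f(x)=\sum a_ix^i\in\mathbb{Z}[x]$, $\|f(x)\|=\sum|a_i|$. Divisibility is in $\mathbb{Z}[x]$. $\log$ is the natural logarithm. *)

theory Defs
  imports Complex_Main "HOL-Computational_Algebra.Polynomial"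
begin

definition poly_norm :: "int poly \<Rightarrow> int" where
  "poly_norm p = (\<Sum>i\<le>degree p. \<bar>coeff p i\<bar>)"

definition x_pow_minus_1 :: "nat \<Rightarrow> int poly" where
  "x_pow_minus_1 k = monom 1 k - 1"

text \<open>
  The integer multiplier is required to be nonzero: every polynomial divides 0,
  so allowing it to vanish would make the condition hold for every exponent.
\<close>

definition dvd_multiple_of_x_pow_minus_1 :: "int poly \<Rightarrow> nat \<Rightarrow> bool" where
  "dvd_multiple_of_x_pow_minus_1 q k \<longleftrightarrow>
     (\<exists>l::int. l \<noteq> 0 \<and> q dvd smult l (x_pow_minus_1 k))"

end

theory Submission
  imports Defs "HOL-Computational_Algebra.Computational_Algebra" "HOL-Number_Theory.Totient"
    "HOL-Analysis.Analysis" "HOL-Real_Asymp.Real_Asymp"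
begin

text \<open>The roots of \<open>q\<close> are simple and are roots of unity, of orders \<open>d\<close> that divide \<open>m\<close> or for which
  the cyclotomic polynomial \<open>\<Phi>\<^sub>d\<close> divides \<open>f\<close>. Every common multiple of these orders is an admissible
  exponent, so it suffices to show that at most \<open>n powr (1/3 + o(1))\<close> primes divide some \<open>d\<close> with
  \<open>\<Phi>\<^sub>d\<close> dividing \<open>f\<close>.

  Let \<open>a\<^sub>r\<close> be the multiplicity of \<open>\<Phi>\<^sub>r\<close> in \<open>f\<close> and write \<open>f = \<Phi>\<^sub>r ^ a\<^sub>r * G\<close>. At a primitive \<open>r\<close>-th root
  of unity \<open>w\<close>, the \<open>a\<^sub>r\<close>-th derivative of \<open>f\<close> is \<open>a\<^sub>r! * \<Phi>\<^sub>r'(w) ^ a\<^sub>r * G(w)\<close>, so the norm of \<open>G(w)\<close>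
  is at most \<open>(n ^ a\<^sub>r * \<parallel>f\<parallel>) ^ totient r\<close>. For a prime \<open>q\<close> not dividing \<open>r\<close> the norm of
  \<open>\<Phi>\<^sub>d(w)\<close> with \<open>d = r * q ^ i\<close> is \<open>q ^ totient r\<close>, so the product of \<open>q ^ a\<^sub>d\<close> over all such \<open>d\<close> is at
  most \<open>n ^ a\<^sub>r * \<parallel>f\<parallel>\<close>. As \<open>a\<^sub>1 = 0\<close>, this bounds \<open>a\<^sub>r\<close> by \<open>O(1)\<close> times the product of
  \<open>2 * ln n / ln q\<close> over the primes \<open>q\<close> dividing \<open>r\<close>, and it bounds the number of primes \<open>p\<close> with
  \<open>\<Phi>\<close> of index \<open>r * p ^ i\<close> dividing \<open>f\<close> by the same quantity times \<open>O(ln n)\<close>. Summed over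
  \<open>totient r \<le> n powr (1/3)\<close>, these bounds give \<open>n powr (1/3 + o(1))\<close>.\<close>

section \<open>Primitive roots of unity\<close>

definition cpoly :: "int poly \<Rightarrow> complex poly" where
  "cpoly F = map_poly of_int F"

abbreviation ipoly :: "int poly \<Rightarrow> complex \<Rightarrow> complex" where
  "ipoly F z \<equiv> poly (cpoly F) z"

lemma coeff_cpoly [simp]: "coeff (cpoly F) i = of_int (coeff F i)"
  by (simp add: cpoly_def coeff_map_poly)

lemma degree_cpoly [simp]: "degree (cpoly F) = degree F"
  by (simp add: cpoly_def degree_map_poly)

lemma cpoly_eq_iff [simp]: "cpoly F = cpoly G \<longleftrightarrow> F = G"
  by (simp add: poly_eq_iff)

lemma cpoly_0 [simp]: "cpoly 0 = 0"
  and cpoly_1 [simp]: "cpoly 1 = 1"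
  and cpoly_add [simp]: "cpoly (F + G) = cpoly F + cpoly G"
  and cpoly_diff [simp]: "cpoly (F - G) = cpoly F - cpoly G"
  and cpoly_uminus [simp]: "cpoly (- F) = - cpoly F"
  and cpoly_smult [simp]: "cpoly (smult a F) = smult (of_int a) (cpoly F)"
  and cpoly_monom [simp]: "cpoly (monom a k) = monom (of_int a) k"
  and cpoly_pCons [simp]: "cpoly (pCons a F) = pCons (of_int a) (cpoly F)"
  and cpoly_pderiv [simp]: "cpoly (pderiv F) = pderiv (cpoly F)"
  and cpoly_mult [simp]: "cpoly (F * G) = cpoly F * cpoly G"
  by (auto simp: poly_eq_iff coeff_pderiv coeff_mult coeff_pCons coeff_1 split: nat.splits)

lemma cpoly_eq_0_iff [simp]: "cpoly F = 0 \<longleftrightarrow> F = 0"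
  using cpoly_eq_iff[of F 0] by simp

lemma cpoly_power [simp]: "cpoly (F ^ k) = cpoly F ^ k"
  by (induction k) auto

lemma cpoly_prod [simp]: "cpoly (prod F A) = (\<Prod>x\<in>A. cpoly (F x))"
  by (induction A rule: infinite_finite_induct) auto

lemma cpoly_pcompose [simp]: "cpoly (pcompose F G) = pcompose (cpoly F) (cpoly G)"
  by (induction F) (auto simp: pcompose_pCons)

text \<open>The multiplier in pseudo-division is a power of the leading coefficient, here 1, so
  pseudo-division by a monic polynomial is true division over the integers.\<close>

lemma monic_int_poly_division:
  fixes F P :: "int poly"
  assumes "lead_coeff P = 1"
  obtains Q R where "F = P * Q + R" "R = 0 \<or> degree R < degree P"
proof -
  obtain Q R where QR: "pseudo_divmod F P = (Q, R)" by fastforce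
  have "P \<noteq> 0" using assms by auto
  from pseudo_divmod[OF this QR] assms that show ?thesis by auto
qed

text \<open>The equivalence for all exponents says that \<open>z\<close> has multiplicative order
  exactly \<open>r\<close>. For \<open>r = 0\<close> it describes the numbers that are not roots of
  unity, hence the recurring assumption \<open>r > 0\<close>.\<close>

definition proots :: "nat \<Rightarrow> complex set" where
  "proots r = {z. \<forall>k. z ^ k = 1 \<longleftrightarrow> r dvd k}"

lemma prootsD: "z \<in> proots r \<Longrightarrow> z ^ k = 1 \<longleftrightarrow> r dvd k"
  by (simp add: proots_def)

lemma exp_in_proots:
  assumes "r > 0"
  shows "exp (2 * of_real pi * \<i> / of_nat r) \<in> proots r"
proof -
  have "exp (2 * of_real pi * \<i> / of_nat r) ^ k = exp (2 * of_real pi * \<i> * of_nat k / of_nat r)" for k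
    by (simp add: exp_of_nat_mult[symmetric] mult_ac)
  then show ?thesis
    using complex_root_unity_eq_1[of r] assms by (auto simp: proots_def)
qed

lemma proots_nonzero: "r > 0 \<Longrightarrow> z \<in> proots r \<Longrightarrow> z \<noteq> 0"
  using prootsD[of z r r] by (auto simp: power_0_left)

lemma proots_order_unique: "z \<in> proots r \<Longrightarrow> z \<in> proots s \<Longrightarrow> r = s"
  by (metis dvd_antisym dvd_refl prootsD)

lemma norm_proots: "r > 0 \<Longrightarrow> z \<in> proots r \<Longrightarrow> norm z = 1"
  by (metis dvd_refl norm_power norm_one power_eq_1_iff norm_ge_zero prootsD gr_implies_not0)

lemma root_of_unity_in_proots:
  fixes z :: complex
  assumes "z ^ k = 1" "k > 0"
  obtains d where "d > 0" "d dvd k" "z \<in> proots d"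
proof -
  define d where "d = (LEAST d. d > 0 \<and> z ^ d = 1)"
  have d: "d > 0" "z ^ d = 1"
    using LeastI[of "\<lambda>d. d > 0 \<and> z ^ d = 1" k] assms by (auto simp: d_def)
  have least: "d \<le> j" if "j > 0" "z ^ j = 1" for j
    using Least_le[of "\<lambda>d. d > 0 \<and> z ^ d = 1" j] that by (auto simp: d_def)
  have "z ^ j = 1 \<longleftrightarrow> d dvd j" for j
  proof
    assume j: "z ^ j = 1"
    have "z ^ j = (z ^ d) ^ (j div d) * z ^ (j mod d)"
      by (simp flip: power_mult power_add)
    then have "z ^ (j mod d) = 1" using d j by simp
    then show "d dvd j" using least[of "j mod d"] d(1)
      by (meson bot_nat_0.not_eq_extremum mod_eq_0_iff_dvd mod_less_divisor not_le)
  next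
    assume "d dvd j" then show "z ^ j = 1" using d by (auto simp: dvd_def power_mult)
  qed
  then have "z \<in> proots d" by (auto simp: proots_def)
  with d assms that show ?thesis by (auto dest: prootsD)
qed

lemma proots_power_coprime: "z \<in> proots r \<Longrightarrow> coprime j r \<Longrightarrow> z ^ j \<in> proots r"
  by (auto simp: proots_def coprime_dvd_mult_right_iff coprime_commute simp flip: power_mult)

lemma proots_power_divisor: "z \<in> proots (a * b) \<Longrightarrow> a > 0 \<Longrightarrow> z ^ a \<in> proots b"
  by (auto simp: proots_def simp flip: power_mult)

lemma proots_power_inj:
  assumes "r > 0" "z \<in> proots r" "z ^ i = z ^ j"
  shows "[i = j] (mod r)"
proof -
  have *: "[i = j] (mod r)" if "i \<le> j" "z ^ i = z ^ j" for i j
  proof -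
    have "z ^ j = z ^ i * z ^ (j - i)" using that power_add[of z i "j - i"] by simp
    then have "z ^ (j - i) = 1" using that proots_nonzero assms by force
    then have "r dvd (j - i)" using assms by (simp add: prootsD)
    then show ?thesis using that by (simp add: cong_altdef_nat cong_sym)
  qed
  show ?thesis
    by (metis * assms(3) cong_sym nle_le)
qed

lemma cong_interval_eq:
  fixes i j r :: nat
  assumes "[i = j] (mod r)" "0 < i" "i \<le> r" "0 < j" "j \<le> r"
  shows "i = j"
proof -
  have *: "i = j" if "i \<le> j" "[j = i] (mod r)" "0 < i" "j \<le> r" for i j
  proof -
    have "r dvd j - i" using that by (simp add: cong_altdef_nat)
    moreover have "j - i < r" using that by linarith
    ultimately have "j - i = 0" by (meson nat_dvd_not_less neq0_conv)
    then show ?thesis using that by simp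
  qed
  show ?thesis
  proof (cases "i \<le> j")
    case True
    then show ?thesis using *[of i j] assms cong_sym by blast
  next
    case False
    then show ?thesis using *[of j i] assms by simp
  qed
qed

text \<open>By counting, the powers of \<open>z\<close> with exponents from 1 to \<open>r\<close>
  are all solutions of \<open>w ^ r = 1\<close>. If \<open>g = gcd j r\<close>, then
  \<open>z ^ j\<close> is already killed by the exponent \<open>r div g\<close>, so order
  \<open>r\<close> forces \<open>g = 1\<close>.\<close>

lemma proots_bij_betw:
  assumes "r > 0" "z \<in> proots r"
  shows "bij_betw (\<lambda>j. z ^ j) (totatives r) (proots r)"
proof -
  have inj: "inj_on (\<lambda>j. z ^ j) {0<..r}"
  proof
    fix i j assume ij: "i \<in> {0<..r}" "j \<in> {0<..r}" "z ^ i = z ^ j"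
    then have "[i = j] (mod r)" using proots_power_inj assms by blast
    then show "i = j" using cong_interval_eq ij by simp
  qed
  have all: "(\<lambda>j. z ^ j) ` {0<..r} = {w. w ^ r = 1}"
  proof (rule card_subset_eq)
    show "finite {w::complex. w ^ r = 1}" using assms by (simp add: finite_roots_unity)
    show "(\<lambda>j. z ^ j) ` {0<..r} \<subseteq> {w. w ^ r = 1}"
      using prootsD[OF assms(2)] by (auto simp flip: power_mult)
    show "card ((\<lambda>j. z ^ j) ` {0<..r}) = card {w::complex. w ^ r = 1}"
      using card_image[OF inj] card_complex_roots_unity[of r] assms by simp
  qed
  have "(\<lambda>j. z ^ j) ` totatives r = proots r"
  proof (intro equalityI subsetI)
    fix w assume w: "w \<in> proots r"
    then have "w ^ r = 1" by (simp add: prootsD)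
    then obtain j where j: "j \<in> {0<..r}" "w = z ^ j" using all by blast
    have "coprime j r"
    proof -
      let ?g = "gcd j r"
      have "j * (r div ?g) = r * (j div ?g)"
        by (metis div_mult_swap dvd_div_mult gcd_dvd1 gcd_dvd2 mult.commute)
      then have "w ^ (r div ?g) = (z ^ r) ^ (j div ?g)"
        unfolding j(2) by (metis power_mult)
      also have "z ^ r = 1" using assms by (simp add: prootsD)
      finally have "r dvd r div ?g" using prootsD[OF w] by simp
      moreover have "r div ?g > 0" using assms(1) by (simp add: div_greater_zero_iff gcd_le2_nat)
      ultimately have "r \<le> r div ?g" by (rule dvd_imp_le)
      then have "\<not> 1 < ?g" using assms(1)
        by (metis div_less_dividend linorder_not_less)
      moreover have "?g > 0" using assms(1) by simp
      ultimately have "?g = 1" by linarith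
      then show ?thesis by (simp add: coprime_iff_gcd_eq_1)
    qed
    then show "w \<in> (\<lambda>j. z ^ j) ` totatives r" using j by (auto simp: totatives_def)
  qed (use assms in \<open>auto simp: totatives_def intro: proots_power_coprime\<close>)
  moreover have "inj_on (\<lambda>j. z ^ j) (totatives r)"
    using inj by (rule inj_on_subset) (auto simp: totatives_def)
  ultimately show ?thesis by (simp add: bij_betw_def)
qed

lemma proots_nonempty: "r > 0 \<Longrightarrow> \<exists>z. z \<in> proots r"
  using exp_in_proots by blast

lemma finite_proots [simp]: "r > 0 \<Longrightarrow> finite (proots r)"
  using bij_betw_finite[OF proots_bij_betw] proots_nonempty[of r] by auto

lemma card_proots: "r > 0 \<Longrightarrow> card (proots r) = totient r"
  using bij_betw_same_card[OF proots_bij_betw] proots_nonempty[of r] by (auto simp: totient_def)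

text \<open>An exponent coprime to \<open>r\<close> can be cancelled modulo \<open>r\<close>, so the
  map is injective on a finite set. It permutes the conjugates, which leaves products over all of
  them unchanged.\<close>

lemma proots_power_bij:
  assumes "r > 0" "coprime j r"
  shows "bij_betw (\<lambda>w. w ^ j) (proots r) (proots r)"
proof -
  have inj: "inj_on (\<lambda>w. w ^ j) (proots r)"
  proof
    fix x y assume xy: "x \<in> proots r" "y \<in> proots r" "x ^ j = y ^ j"
    obtain i where i: "y = x ^ i"
      using proots_bij_betw[OF assms(1) xy(1)] xy(2) by (auto simp: bij_betw_def)
    have "[j = i * j] (mod r)" using proots_power_inj[OF assms(1) xy(1)] xy(3) i
      by (simp add: power_mult)
    then have "[1 = i] (mod r)" using cong_mult_rcancel_nat[of j r 1 i] assms(2)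
      by simp
    then obtain a b where "1 + a * r = i + b * r" by (metis cong_iff_lin_nat mult.commute)
    then have "x ^ (1 + a * r) = x ^ (i + b * r)" by simp
    moreover have "x ^ (a * r) = 1" "x ^ (b * r) = 1" by (simp_all add: prootsD[OF xy(1)])
    ultimately show "x = y" using i by (simp add: power_add)
  qed
  moreover have "(\<lambda>w. w ^ j) ` proots r \<subseteq> proots r"
    using assms by (auto intro: proots_power_coprime)
  ultimately show ?thesis
    using assms(1) by (metis bij_betw_def endo_inj_surj finite_proots)
qed

section \<open>Conjugates of roots of unity\<close>

lemma ipoly_x_pow_minus_1 [simp]: "ipoly (x_pow_minus_1 k) z = z ^ k - 1"
  by (simp add: x_pow_minus_1_def poly_monom)

lemma x_pow_minus_1_nonzero: "k > 0 \<Longrightarrow> x_pow_minus_1 k \<noteq> 0"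
  by (metis diff_0 diff_eq_eq ipoly_x_pow_minus_1 cpoly_0 poly_0 power_0_left neg_equal_0_iff_equal not_gr0 one_neq_zero zero_neq_one)

lemma x_pow_minus_1_altdef: "k > 0 \<Longrightarrow> x_pow_minus_1 k = monom 1 k + [:-1:]"
  by (simp add: x_pow_minus_1_def poly_eq_iff coeff_pCons split: nat.splits)

lemma degree_x_pow_minus_1: "degree (x_pow_minus_1 k) = k"
proof (cases "k = 0")
  case False
  have "degree (monom 1 k + [:-1::int:]) = degree (monom (1::int) k)"
    by (rule degree_add_eq_left) (use False in \<open>simp add: degree_monom_eq\<close>)
  then show ?thesis using False by (simp add: x_pow_minus_1_altdef degree_monom_eq)
qed (simp add: x_pow_minus_1_def)

lemma lead_coeff_x_pow_minus_1: "k > 0 \<Longrightarrow> lead_coeff (x_pow_minus_1 k) = 1"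
  unfolding degree_x_pow_minus_1 by (simp add: x_pow_minus_1_altdef coeff_pCons split: nat.splits)

lemma pderiv_x_pow_minus_1: "pderiv (x_pow_minus_1 k) = monom (int k) (k - 1)"
  by (simp add: x_pow_minus_1_def pderiv_diff pderiv_monom)

section \<open>The minimal polynomial of a root of unity over the integers\<close>

lemma prime_factor_with_root:
  assumes "F \<noteq> 0" "ipoly F z = 0"
  shows "\<exists>P. prime_elem P \<and> P dvd F \<and> ipoly P z = 0"
  using assms
proof (induction F rule: prime_divisors_induct)
  case (unit x)
  then obtain y where "1 = x * y" by (elim dvdE)
  then have "cpoly 1 = cpoly x * cpoly y" by (metis cpoly_mult)
  then have "1 = ipoly x z * ipoly y z" by (metis cpoly_1 poly_1 poly_mult)
  with unit show ?case by simp
next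
  case (factor p x)
  show ?case
  proof (cases "ipoly p z = 0")
    case True
    then show ?thesis using factor.hyps by (intro exI[of _ p]) auto
  next
    case False
    then have "ipoly x z = 0" "x \<noteq> 0" using factor.prems by auto
    then show ?thesis using factor.IH by (meson dvd_mult)
  qed
qed simp

text \<open>Take a prime factor \<open>P\<close> of a nonzero polynomial of least degree vanishing
  at \<open>z\<close>. Pseudo-division shows that \<open>P\<close> divides a nonzero integer
  multiple of each \<open>F\<close> vanishing at \<open>z\<close>; being prime and not dividing the
  constant, it divides \<open>F\<close> itself, as in Gauss's lemma. Its leading coefficient is a
  unit because \<open>P\<close> divides the monic \<open>x_pow_minus_1 r\<close>.\<close>

lemma integral_minimal_polynomial:
  assumes "r > 0" "z \<in> proots r"
  obtains P where "prime_elem P" "lead_coeff P = 1" "\<And>F. ipoly F z = 0 \<longleftrightarrow> P dvd F"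
proof -
  let ?root = "\<lambda>F. F \<noteq> 0 \<and> ipoly F z = 0"
  have X: "?root (x_pow_minus_1 r)"
    using assms by (simp add: x_pow_minus_1_nonzero prootsD)
  define M where "M = arg_min degree ?root"
  have M: "?root M" and M_min: "\<And>F. ?root F \<Longrightarrow> degree M \<le> degree F"
    using arg_min_nat_lemma[of ?root, OF X] by (auto simp: M_def)
  obtain P where P: "prime_elem P" "P dvd M" "ipoly P z = 0"
    using prime_factor_with_root M by blast
  have P0: "P \<noteq> 0" using P(1) by auto
  have P_min: "degree P \<le> degree F" if "?root F" for F
    using M_min[OF that] dvd_imp_degree_le[OF P(2)] M by linarith
  have dvd: "P dvd F" if F: "ipoly F z = 0" for F
  proof -
    obtain Q R where QR: "pseudo_divmod F P = (Q, R)" by fastforce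
    define l where "l = coeff P (degree P) ^ (Suc (degree F) - degree P)"
    have l: "l \<noteq> 0" using P0 by (simp add: l_def)
    have eq: "smult l F = P * Q + R" and deg: "R = 0 \<or> degree R < degree P"
      using pseudo_divmod[OF P0 QR] by (auto simp: l_def)
    have "cpoly (smult l F) = cpoly (P * Q + R)" by (simp only: eq)
    then have "of_int l * ipoly F z = ipoly P z * ipoly Q z + ipoly R z"
      by (metis cpoly_add cpoly_mult cpoly_smult poly_add poly_mult poly_smult)
    then have "ipoly R z = 0" using F P(3) by simp
    then have "R = 0" using deg P_min[of R] by fastforce
    then have "P dvd [:l:] * F" using eq by simp
    moreover have "\<not> P dvd [:l:]"
    proof
      assume "P dvd [:l:]"
      then obtain S where "[:l:] = P * S" by (elim dvdE)
      then have "ipoly [:l:] z = ipoly P z * ipoly S z" by (metis cpoly_mult poly_mult)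
      then show False using P(3) l by simp
    qed
    ultimately show ?thesis using prime_elem_dvd_multD[OF P(1)] by blast
  qed
  have iff: "ipoly F z = 0 \<longleftrightarrow> P dvd F" for F
    using dvd P(3) by (auto elim!: dvdE)
  obtain H where "x_pow_minus_1 r = P * H" using dvd X by blast
  then have "lead_coeff P * lead_coeff H = 1"
    using lead_coeff_x_pow_minus_1[OF assms(1)] by (metis lead_coeff_mult)
  then have "lead_coeff P = 1 \<or> lead_coeff P = -1"
    using pos_zmult_eq_1_iff_lemma by blast
  then show ?thesis
  proof
    assume "lead_coeff P = 1"
    then show ?thesis using that[of P] P(1) iff by blast
  next
    assume "lead_coeff P = -1"
    moreover have "prime_elem (-P)"
      using P(1) prime_elem_mult_unit_left[of "-1" P] by simp
    ultimately show ?thesis using that[of "-P"] iff by simp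
  qed
qed

section \<open>Frobenius congruences and conjugation\<close>

lemma freshman_dream_dvd:
  fixes A B :: "'a :: comm_ring_1"
  assumes "prime p"
  shows "of_nat p dvd (A + B) ^ p - (A ^ p + B ^ p)"
proof -
  have p: "p > 1" using assms by (rule prime_gt_1_nat)
  let ?t = "\<lambda>k. of_nat (p choose k) * A ^ k * B ^ (p - k)"
  have "(A + B) ^ p = (\<Sum>k\<le>p. ?t k)" by (rule binomial_ring)
  also have "{..p} = insert 0 (insert p {0<..<p})" using p by auto
  also have "(\<Sum>k\<in>\<dots>. ?t k) = B ^ p + (A ^ p + (\<Sum>k\<in>{0<..<p}. ?t k))"
    using p by simp
  finally have "(A + B) ^ p - (A ^ p + B ^ p) = (\<Sum>k\<in>{0<..<p}. ?t k)" by simp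
  also have "of_nat p dvd \<dots>"
  proof (intro dvd_sum dvd_mult2)
    fix k assume "k \<in> {0<..<p}"
    then have "p dvd (p choose k)" using assms by (intro dvd_choose_prime) auto
    then show "(of_nat p :: 'a) dvd of_nat (p choose k)" by (auto elim!: dvdE)
  qed
  finally show ?thesis .
qed

lemma fermat_dvd:
  fixes a :: int
  assumes "prime p"
  shows "int p dvd a ^ p - a"
proof (induction a rule: int_induct[where k = 0])
  case base
  then show ?case using assms by (simp add: power_0_left prime_gt_0_nat)
next
  case (step1 i)
  have "(i + 1) ^ p - (i + 1) = ((i + 1) ^ p - (i ^ p + 1 ^ p)) + (i ^ p - i)" by simp
  then show ?case using freshman_dream_dvd[OF assms, of i 1] step1 by (metis dvd_add of_nat_id of_nat_eq_id)
next
  case (step2 i)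
  have "(i - 1) ^ p - (i - 1) = (i ^ p - i) - ((i - 1 + 1) ^ p - ((i - 1) ^ p + 1 ^ p))" by simp
  then show ?case using freshman_dream_dvd[OF assms, of "i - 1" 1] step2 by (metis dvd_diff)
qed

text \<open>Induction on the coefficients: writing the polynomial as \<open>a + x * P\<close>, the
  constant term is handled by Fermat's congruence, and the mixed terms of the \<open>p\<close>-th
  power are divisible by \<open>p\<close>.\<close>

lemma frobenius_dvd:
  fixes P :: "int poly"
  assumes "prime p"
  shows "of_nat p dvd pcompose P (monom 1 p) - P ^ p"
proof (induction P)
  case 0
  then show ?case using assms by (simp add: power_0_left prime_gt_0_nat)
next
  case (pCons a P)
  have X: "([:0, 1:] * P) ^ p = monom 1 p * P ^ p"
    by (simp add: power_mult_distrib monom_altdef del: mult_pCons_left)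
  have eq: "pCons a P = [:a:] + [:0, 1:] * P" by simp
  have "pcompose (pCons a P) (monom 1 p) - pCons a P ^ p
    = ([:a:] - [:a:] ^ p) + monom 1 p * (pcompose P (monom 1 p) - P ^ p)
      - (([:a:] + [:0, 1:] * P) ^ p - ([:a:] ^ p + ([:0, 1:] * P) ^ p))"
    unfolding pcompose_pCons eq[symmetric] X by (simp add: algebra_simps)
  moreover have "of_nat p dvd [:a:] - [:a:] ^ p"
  proof -
    obtain b where "a ^ p - a = int p * b" using fermat_dvd[OF assms, of a] by (elim dvdE)
    then have "a - a ^ p = int p * (-b)" by simp
    then have "[:a:] - [:a:] ^ p = of_nat p * [:-b:]"
      by (simp add: poly_const_pow of_nat_poly)
    then show ?thesis by (metis dvd_triv_left)
  qed
  moreover have "of_nat p dvd monom 1 p * (pcompose P (monom 1 p) - P ^ p)"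
    using pCons.IH by (rule dvd_mult)
  ultimately show ?case
    using freshman_dream_dvd[OF assms, of "[:a:]" "[:0, 1:] * P"] by (metis dvd_add dvd_diff)
qed

text \<open>If \<open>z ^ p\<close> were not a root of the minimal polynomial \<open>P\<close> of \<open>z\<close>, then differentiating
  \<open>x ^ r - 1 = P * H\<close> at \<open>z ^ p\<close> gives \<open>r = z ^ p * P(z ^ p) * H'(z ^ p)\<close>, while \<open>P(z ^ p)\<close> is \<open>p\<close>
  times an integer polynomial in \<open>z\<close> by the Frobenius congruence; this contradicts that \<open>p\<close> does
  not divide \<open>r\<close>.\<close>

lemma conjugate_prime_power_root:
  assumes "r > 0" "z \<in> proots r" "prime p" "\<not> p dvd r" "ipoly F z = 0"
  shows "ipoly F (z ^ p) = 0"
proof -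
  obtain P where P: "prime_elem P" "lead_coeff P = 1" "\<And>F. ipoly F z = 0 \<longleftrightarrow> P dvd F"
    using integral_minimal_polynomial[OF assms(1,2)] by metis
  have "ipoly P (z ^ p) = 0"
  proof (rule ccontr)
    assume nz: "ipoly P (z ^ p) \<noteq> 0"
    have "P dvd x_pow_minus_1 r" using P(3)[of "x_pow_minus_1 r"] assms by (simp add: prootsD)
    then obtain H where H: "x_pow_minus_1 r = P * H" by (elim dvdE)
    have zr: "(z ^ p) ^ r = 1" using assms(2) by (simp add: prootsD flip: power_mult)
    have "ipoly (P * H) (z ^ p) = 0" unfolding H[symmetric] using zr by simp
    then have H0: "ipoly H (z ^ p) = 0" using nz by simp
    have "ipoly (pderiv (x_pow_minus_1 r)) (z ^ p) = ipoly P (z ^ p) * ipoly (pderiv H) (z ^ p)"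
      unfolding H by (simp add: pderiv_mult H0)
    then have eq1: "of_nat r * (z ^ p) ^ (r - 1) = ipoly P (z ^ p) * ipoly (pderiv H) (z ^ p)"
      by (simp add: pderiv_x_pow_minus_1 poly_monom)
    obtain G where "pcompose P (monom 1 p) - P ^ p = of_nat p * G"
      using frobenius_dvd[OF assms(3), of P] by (elim dvdE)
    then have "pcompose P (monom 1 p) = P ^ p + smult (int p) G"
      by (simp add: of_nat_poly algebra_simps)
    then have "ipoly (pcompose P (monom 1 p)) z = ipoly P z ^ p + of_nat p * ipoly G z"
      by simp
    moreover have "ipoly P z = 0" using P(3)[of P] by simp
    ultimately have eq2: "ipoly P (z ^ p) = of_nat p * ipoly G z"
      using assms(3) by (simp add: power_0_left prime_gt_0_nat poly_pcompose poly_monom)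
    define W where "W = monom 1 p * G * pcompose (pderiv H) (monom 1 p)"
    have "(z ^ p) ^ (r - 1) * z ^ p = 1" using zr assms(1) by (metis power_minus_mult)
    then have "of_nat r = of_nat r * (z ^ p) ^ (r - 1) * z ^ p" by (simp add: mult.assoc)
    also have "\<dots> = of_nat p * ipoly W z"
      unfolding eq1 eq2 by (simp add: W_def poly_monom poly_pcompose)
    finally have rW: "of_nat r = of_nat p * ipoly W z" .
    obtain Q R where QR: "W = P * Q + R" "R = 0 \<or> degree R < degree P"
      using monic_int_poly_division[OF P(2)] by metis
    \<comment> \<open>Reduction of \<open>W\<close> modulo \<open>P\<close> keeps the degree of
      \<open>D\<close> below that of the minimal polynomial. As \<open>D\<close> vanishes at
      \<open>z\<close>, it is zero, and its constant coefficient exhibits \<open>r\<close> as a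
      multiple of \<open>p\<close>.\<close>
    define D where "D = [:int r:] - smult (int p) R"
    have "ipoly D z = 0" using rW \<open>ipoly P z = 0\<close> unfolding D_def QR(1) by simp
    then have "P dvd D" using P(3) by blast
    have "degree P > 0"
    proof (rule ccontr)
      assume "\<not> degree P > 0"
      then have "P = 1" using P(2) by (metis degree_0_id gr0I monom_0 monom_eq_1 of_int_1 lead_coeff_1 degree_eq_zeroE lead_coeff_pCons(2) one_pCons)
      then show False using P(1) by simp
    qed
    then have "degree D < degree P"
      unfolding D_def using QR(2) by (intro degree_diff_less) auto
    then have "D = 0" using \<open>P dvd D\<close> by (metis dvd_imp_degree_le linorder_not_less)
    then have "coeff D 0 = 0" by simp
    then have "int r = int p * coeff R 0" by (simp add: D_def)
    then have "int p dvd int r" by simp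
    with assms(4) show False by simp
  qed
  moreover have "P dvd F" using P(3) assms(5) by blast
  ultimately show ?thesis by (auto elim!: dvdE)
qed

text \<open>The prime case is applied to the prime factors of \<open>j\<close> one after another;
  each intermediate power of \<open>z\<close> is again primitive of order \<open>r\<close>, so
  \<open>z\<close> must be arbitrary in the induction.\<close>

lemma conjugate_root:
  assumes "r > 0" "z \<in> proots r" "coprime j r" "ipoly F z = 0"
  shows "ipoly F (z ^ j) = 0"
proof (cases "j = 0")
  case True
  then have "z = 1" using assms prootsD[of z r 1] by simp
  then show ?thesis using assms True by simp
next
  case False
  then show ?thesis using assms
  proof (induction j arbitrary: z rule: prime_divisors_induct)
    case (factor p x)
    have "coprime p r" "coprime x r" using factor.prems by auto
    then have "\<not> p dvd r" using factor.hyps by (metis coprime_absorb_left not_prime_unit)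
    then have "ipoly F (z ^ p) = 0"
      using conjugate_prime_power_root factor by blast
    moreover have "z ^ p \<in> proots r"
      using factor.prems \<open>coprime p r\<close> by (intro proots_power_coprime)
    ultimately have "ipoly F ((z ^ p) ^ x) = 0"
      using factor.IH[of "z ^ p"] factor.prems \<open>coprime x r\<close> by simp
    then show ?case by (simp add: power_mult)
  qed auto
qed

section \<open>Cyclotomic polynomials and norms\<close>

text \<open>The cyclotomic polynomial, for \<open>r > 0\<close>, chosen as the common minimal
  polynomial of all primitive roots. Integrality and primality are thus built in; existence rests on
  \<open>conjugate_root\<close>, and the product formula is recovered in
  \<open>cpoly_Phi\<close>.\<close>

definition Phi :: "nat \<Rightarrow> int poly" where
  "Phi r = (SOME P. prime_elem P \<and> lead_coeff P = 1 \<and>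
     (\<forall>z\<in>proots r. \<forall>F. ipoly F z = 0 \<longleftrightarrow> P dvd F))"

lemma Phi:
  assumes "r > 0"
  shows prime_elem_Phi: "prime_elem (Phi r)"
    and lead_coeff_Phi: "lead_coeff (Phi r) = 1"
    and ipoly_eq_0_iff_Phi_dvd: "z \<in> proots r \<Longrightarrow> ipoly F z = 0 \<longleftrightarrow> Phi r dvd F"
proof -
  obtain w where w: "w \<in> proots r" using proots_nonempty assms by blast
  obtain P where P: "prime_elem P" "lead_coeff P = 1" "\<And>F. ipoly F w = 0 \<longleftrightarrow> P dvd F"
    using integral_minimal_polynomial[OF assms w] by metis
  have "ipoly F z = 0 \<longleftrightarrow> P dvd F" if z: "z \<in> proots r" for z F
  proof -
    have conj: "ipoly F v = 0" if uv: "u \<in> proots r" "v \<in> proots r" "ipoly F u = 0" for u v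
    proof -
      obtain j where "j \<in> totatives r" "v = u ^ j"
        using proots_bij_betw[OF assms uv(1)] uv(2) by (auto simp: bij_betw_def)
      then show ?thesis
        using conjugate_root[OF assms uv(1) _ uv(3)] by (simp add: in_totatives_iff)
    qed
    show ?thesis using conj[OF w z] conj[OF z w] P(3) by blast
  qed
  with P have "\<exists>P. prime_elem P \<and> lead_coeff P = 1 \<and>
     (\<forall>z\<in>proots r. \<forall>F. ipoly F z = 0 \<longleftrightarrow> P dvd F)" by blast
  from someI_ex[OF this] show "prime_elem (Phi r)" "lead_coeff (Phi r) = 1"
    "z \<in> proots r \<Longrightarrow> ipoly F z = 0 \<longleftrightarrow> Phi r dvd F"
    unfolding Phi_def by blast+
qed

lemma Phi_nonzero: "r > 0 \<Longrightarrow> Phi r \<noteq> 0"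
  using prime_elem_Phi not_prime_elem_zero by metis

lemma Phi_dvd_x_pow_minus_1_iff: "r > 0 \<Longrightarrow> Phi r dvd x_pow_minus_1 k \<longleftrightarrow> r dvd k"
  using proots_nonempty[of r] ipoly_eq_0_iff_Phi_dvd[of r _ "x_pow_minus_1 k"] prootsD by auto

lemma Phi_dvd_Phi_imp_eq:
  assumes "r > 0" "s > 0" "Phi r dvd Phi s"
  shows "r = s"
proof -
  have "Phi s dvd Phi r"
    using assms by (meson prime_elem_Phi prime_elem_imp_irreducible irreducibleD' prime_elem_not_unit)
  then show ?thesis
    using assms by (metis Phi_dvd_x_pow_minus_1_iff dvd_antisym dvd_refl dvd_trans)
qed

lemma ipoly_Phi_eq_0_iff:
  assumes "r > 0"
  shows "ipoly (Phi r) w = 0 \<longleftrightarrow> w \<in> proots r"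
proof
  assume w: "ipoly (Phi r) w = 0"
  obtain S where S: "x_pow_minus_1 r = Phi r * S"
    using Phi_dvd_x_pow_minus_1_iff[of r r] assms by (auto elim: dvdE)
  have "ipoly (Phi r * S) w = 0" using w by simp
  then have "w ^ r = 1" unfolding S[symmetric] by simp
  then obtain d where d: "d > 0" "d dvd r" "w \<in> proots d"
    using root_of_unity_in_proots assms by blast
  then have "Phi d dvd Phi r" using ipoly_eq_0_iff_Phi_dvd w by blast
  then show "w \<in> proots r" using Phi_dvd_Phi_imp_eq d assms by blast
next
  assume "w \<in> proots r"
  then show "ipoly (Phi r) w = 0" using ipoly_eq_0_iff_Phi_dvd[OF assms, of w "Phi r"] by simp
qed

text \<open>A double root would also be a double root of \<open>x_pow_minus_1 r\<close>, whose
  derivative vanishes at most at 0. Hence the roots are simple and the monic polynomial is the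
  product over them.\<close>

lemma cpoly_Phi:
  assumes "r > 0"
  shows "cpoly (Phi r) = (\<Prod>w\<in>proots r. [:-w, 1:])"
proof -
  obtain S where S: "x_pow_minus_1 r = Phi r * S"
    using Phi_dvd_x_pow_minus_1_iff[of r r] assms by (auto elim: dvdE)
  have "rsquarefree (cpoly (Phi r))"
    unfolding rsquarefree_roots
  proof (intro allI notI, elim conjE)
    fix w assume w: "ipoly (Phi r) w = 0" "poly (pderiv (cpoly (Phi r))) w = 0"
    have "ipoly (pderiv (Phi r * S)) w = 0"
      using w by (simp add: pderiv_mult)
    then have "ipoly (pderiv (x_pow_minus_1 r)) w = 0" unfolding S .
    then have "of_nat r * w ^ (r - 1) = 0"
      by (simp add: pderiv_x_pow_minus_1 poly_monom del: cpoly_pderiv)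
    then have "w = 0" using assms by simp
    then show False using w assms ipoly_Phi_eq_0_iff proots_nonzero by blast
  qed
  from complex_poly_decompose_rsquarefree[OF this] show ?thesis
    using lead_coeff_Phi[OF assms] by (simp add: ipoly_Phi_eq_0_iff assms)
qed

lemma degree_Phi: "r > 0 \<Longrightarrow> degree (Phi r) = totient r"
proof -
  assume r: "r > 0"
  have "degree (cpoly (Phi r)) = (\<Sum>w\<in>proots r. degree [:-w, 1:])"
    unfolding cpoly_Phi[OF r] by (rule degree_prod_eq_sum_degree) auto
  then show ?thesis using r by (simp add: card_proots)
qed

text \<open>For \<open>r > 0\<close> this is the field norm of \<open>F(w)\<close> at a primitive
  root \<open>w\<close>, or equally the resultant of \<open>Phi r\<close> and
  \<open>F\<close>.\<close>

definition pnorm :: "nat \<Rightarrow> int poly \<Rightarrow> complex" where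
  "pnorm r F = (\<Prod>w\<in>proots r. ipoly F w)"

lemma pnorm_mult: "pnorm r (F * G) = pnorm r F * pnorm r G"
  by (simp add: pnorm_def prod.distrib)

lemma pnorm_power: "pnorm r (F ^ k) = pnorm r F ^ k"
  by (simp add: pnorm_def prod_power_distrib)

lemma pnorm_prod: "pnorm r (prod F A) = (\<Prod>x\<in>A. pnorm r (F x))"
  by (induction A rule: infinite_finite_induct) (auto simp: pnorm_mult, auto simp: pnorm_def)

lemma pnorm_eq_0_iff: "r > 0 \<Longrightarrow> pnorm r F = 0 \<longleftrightarrow> Phi r dvd F"
  unfolding pnorm_def using ipoly_eq_0_iff_Phi_dvd proots_nonempty by fastforce

text \<open>At every primitive root \<open>H\<close> takes the value of the norm. Its remainder
  modulo \<open>Phi r\<close> is an integer polynomial of degree below \<open>totient r\<close> with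
  the same value at \<open>totient r\<close> points, so it is constant, and its constant coefficient
  is the norm.\<close>

lemma pnorm_in_Ints:
  assumes "r > 0"
  shows "pnorm r F \<in> \<int>"
proof -
  define H where "H = (\<Prod>j\<in>totatives r. pcompose F (monom 1 j))"
  have H: "ipoly H w = pnorm r F" if "w \<in> proots r" for w
  proof -
    have "ipoly H w = (\<Prod>j\<in>totatives r. ipoly F (w ^ j))"
      by (simp add: H_def poly_prod poly_pcompose poly_monom)
    also have "\<dots> = pnorm r F"
      unfolding pnorm_def using prod.reindex_bij_betw[OF proots_bij_betw[OF assms that]] by blast
    finally show ?thesis .
  qed
  obtain Q R where QR: "H = Phi r * Q + R" "R = 0 \<or> degree R < degree (Phi r)"
    using monic_int_poly_division[OF lead_coeff_Phi[OF assms]] by metis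
  have R: "ipoly R w = pnorm r F" if "w \<in> proots r" for w
    using H[OF that] ipoly_Phi_eq_0_iff[OF assms, of w] that by (simp add: QR(1))
  let ?E = "cpoly R - [:pnorm r F:]"
  have "?E = 0"
  proof (rule ccontr)
    assume nz: "?E \<noteq> 0"
    have "proots r \<subseteq> {w. poly ?E w = 0}" using R by auto
    then have "card (proots r) \<le> card {w. poly ?E w = 0}"
      by (rule card_mono[OF poly_roots_finite[OF nz]])
    also have "\<dots> \<le> degree ?E" using nz by (rule card_poly_roots_bound)
    also have "\<dots> < degree (Phi r)"
      using QR(2) assms by (intro degree_diff_less) (auto simp: degree_Phi)
    finally show False using assms by (simp add: card_proots degree_Phi)
  qed
  then have "coeff ?E 0 = 0" by simp
  then have "pnorm r F = of_int (coeff R 0)" by simp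
  then show ?thesis by simp
qed

lemma norm_pnorm_ge_1:
  assumes "r > 0" "\<not> Phi r dvd F"
  shows "norm (pnorm r F) \<ge> 1"
proof -
  obtain a where a: "pnorm r F = of_int a" using pnorm_in_Ints[OF assms(1), of F] by (elim Ints_cases)
  then have "a \<noteq> 0" using pnorm_eq_0_iff assms by auto
  then show ?thesis unfolding a by (simp flip: of_int_abs)
qed

text \<open>Since \<open>z ^ q\<close> is primitive of order \<open>r\<close> along with
  \<open>z\<close>, \<open>Phi r\<close> divides its substitution of \<open>x ^ q\<close>, and hence
  \<open>?A\<close> divides \<open>?C\<close>. A primitive root \<open>y\<close> of order
  \<open>?d\<close> is a root of \<open>?C\<close> but not of \<open>?A\<close>, because
  \<open>y ^ (q ^ k)\<close> has order \<open>r * q\<close>. So the product on the right divides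
  \<open>?C\<close>; equal degrees and leading coefficients make the cofactor 1.\<close>

lemma Phi_pcompose_prime_power:
  assumes "r > 0" "prime q" "\<not> q dvd r"
  shows "pcompose (Phi r) (monom 1 (q ^ Suc k)) = pcompose (Phi r) (monom 1 (q ^ k)) * Phi (r * q ^ Suc k)"
    (is "?C = ?A * Phi ?d")
proof -
  have q: "q > 1" using assms(2) by (rule prime_gt_1_nat)
  have d: "?d > 0" using assms q by simp
  have cop: "coprime q r" using assms by (simp add: prime_imp_coprime)
  obtain z where z: "z \<in> proots r" using proots_nonempty assms(1) by blast
  obtain y where y: "y \<in> proots ?d" using proots_nonempty d by blast
  have "z ^ q \<in> proots r" using z cop by (rule proots_power_coprime)
  then have "ipoly (pcompose (Phi r) (monom 1 q)) z = 0"
    using assms(1) by (simp add: poly_pcompose poly_monom ipoly_Phi_eq_0_iff)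
  then have "Phi r dvd pcompose (Phi r) (monom 1 q)"
    using ipoly_eq_0_iff_Phi_dvd assms(1) z by blast
  then obtain S where S: "pcompose (Phi r) (monom 1 q) = Phi r * S" by (elim dvdE)
  have "?C = pcompose (pcompose (Phi r) (monom 1 q)) (monom 1 (q ^ k))"
    by (subst poly_eq_poly_eq_iff[symmetric])
       (simp add: fun_eq_iff poly_pcompose poly_monom power_mult mult.commute flip: power_mult)
  then have C1: "?C = ?A * pcompose S (monom 1 (q ^ k))" by (simp add: S pcompose_mult)
  have "y ^ (q ^ Suc k) \<in> proots r"
    using proots_power_divisor[of y "q ^ Suc k" r] y q by (simp add: mult.commute)
  then have "ipoly ?C y = 0"
    using assms(1) by (simp add: poly_pcompose poly_monom ipoly_Phi_eq_0_iff)
  then have dC: "Phi ?d dvd ?C" using ipoly_eq_0_iff_Phi_dvd d y by blast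
  have "y ^ (q ^ k) \<in> proots (r * q)"
    using proots_power_divisor[of y "q ^ k" "r * q"] y q by (simp add: mult_ac)
  then have "y ^ (q ^ k) \<notin> proots r"
    using proots_order_unique[of _ r "r * q"] assms(1) q by auto
  then have "ipoly ?A y \<noteq> 0"
    using assms(1) by (simp add: poly_pcompose poly_monom ipoly_Phi_eq_0_iff)
  then have "\<not> Phi ?d dvd ?A" using ipoly_eq_0_iff_Phi_dvd d y by blast
  then have "Phi ?d dvd pcompose S (monom 1 (q ^ k))"
    using prime_elem_dvd_multD[OF prime_elem_Phi[OF d]] dC C1 by metis
  then obtain T where T: "?C = ?A * Phi ?d * T" using C1 by (auto elim!: dvdE simp: mult.assoc)
  have deg: "degree (pcompose (Phi r) (monom 1 m)) = totient r * m" for m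
    using assms(1) by (simp add: degree_pcompose degree_Phi degree_monom_eq)
  have lc: "lead_coeff (pcompose (Phi r) (monom 1 m)) = 1" if "m > 0" for m
    using that lead_coeff_Phi[OF assms(1)]
    by (subst lead_coeff_comp) (auto simp: degree_monom_eq)
  have lcA: "lead_coeff ?A = 1" "lead_coeff ?C = 1" using lc q by (simp_all del: power_Suc)
  then have nz: "?A \<noteq> 0" "?C \<noteq> 0" by auto
  then have "T \<noteq> 0" using T by auto
  have "totient ?d = totient r * totient (q ^ Suc k)"
    using cop by (intro totient_mult_coprime) (simp add: coprime_commute)
  also have "totient (q ^ Suc k) = q ^ k * (q - 1)" by (rule totient_prime_power_Suc[OF assms(2)])
  finally have tot: "totient ?d = totient r * (q ^ k * (q - 1))" .
  have "totient r * q ^ Suc k = totient r * q ^ k + totient ?d + degree T"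
    using arg_cong[OF T, of degree] nz \<open>T \<noteq> 0\<close> Phi_nonzero[OF d]
    by (simp add: degree_mult_eq deg degree_Phi[OF d] del: power_Suc)
  moreover have "totient r * q ^ Suc k = totient r * q ^ k + totient r * (q ^ k * (q - 1))"
    using q by (cases q) (auto simp: algebra_simps)
  ultimately have "degree T = 0" using tot by linarith
  moreover have "lead_coeff ?C = lead_coeff ?A * lead_coeff (Phi ?d) * lead_coeff T"
    using arg_cong[OF T, of lead_coeff] by (simp only: lead_coeff_mult)
  then have "lead_coeff T = 1" using lcA lead_coeff_Phi[OF d] by simp
  ultimately have "T = 1" by (metis degree_eq_zeroE degree_pCons_0 coeff_pCons_0 one_pCons)
  then show ?thesis using T by simp
qed

text \<open>At a primitive \<open>r\<close>-th root both sides of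
  \<open>Phi_pcompose_prime_power\<close> vanish, so their derivatives are compared instead. Raising
  to powers of \<open>q\<close> permutes these roots, hence the derivative of \<open>Phi r\<close>
  contributes the same nonzero product \<open>N\<close> to both sides. Cancelling it leaves one
  factor \<open>q\<close> for each root.\<close>

lemma norm_pnorm_Phi_prime_power:
  assumes "r > 0" "prime q" "\<not> q dvd r" "i > 0"
  shows "norm (pnorm r (Phi (r * q ^ i))) = real q ^ totient r"
proof -
  obtain k where i: "i = Suc k" using assms(4) by (cases i) auto
  have q: "q > 0" using assms(2) by (simp add: prime_gt_0_nat)
  have cop: "coprime (q ^ m) r" for m using assms by (simp add: prime_imp_coprime)
  let ?P = "Phi r" and ?d = "r * q ^ Suc k"
  let ?g = "\<lambda>w. norm (ipoly (pderiv ?P) w)"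
  define N where "N = (\<Prod>w\<in>proots r. ?g w)"
  have "\<not> ?P dvd pderiv ?P" using assms(1) by (simp add: degree_Phi)
  then have "pnorm r (pderiv ?P) \<noteq> 0"
    using pnorm_eq_0_iff[OF assms(1), of "pderiv ?P"] by blast
  moreover have "N = norm (pnorm r (pderiv ?P))"
    unfolding N_def pnorm_def by (rule prod_norm)
  ultimately have N0: "N \<noteq> 0" by simp
  have N: "(\<Prod>w\<in>proots r. ?g (w ^ (q ^ m))) = N" for m
    unfolding N_def by (rule prod.reindex_bij_betw[OF proots_power_bij[OF assms(1) cop]])
  have "?g (w ^ (q ^ Suc k)) * real q ^ Suc k = ?g (w ^ (q ^ k)) * real q ^ k * norm (ipoly (Phi ?d) w)"
    if w: "w \<in> proots r" for w
  proof -
    have w1: "norm w = 1" using norm_proots assms(1) w by blast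
    have A0: "ipoly ?P (w ^ (q ^ k)) = 0"
      using proots_power_coprime[OF w cop] by (simp add: ipoly_Phi_eq_0_iff assms(1))
    have "pderiv (pcompose ?P (monom 1 (q ^ Suc k))) = pderiv (pcompose ?P (monom 1 (q ^ k)) * Phi ?d)"
      using Phi_pcompose_prime_power[OF assms(1-3)] by simp
    then have "ipoly (pderiv (pcompose ?P (monom 1 (q ^ Suc k)))) w
      = ipoly (pderiv (pcompose ?P (monom 1 (q ^ k)) * Phi ?d)) w" by simp
    then have "poly (pderiv (cpoly ?P)) (w ^ (q ^ Suc k)) * (of_nat (q ^ Suc k) * w ^ (q ^ Suc k - 1))
      = ipoly (Phi ?d) w * (poly (pderiv (cpoly ?P)) (w ^ (q ^ k)) * (of_nat (q ^ k) * w ^ (q ^ k - 1)))"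
      using A0 by (simp add: pderiv_pcompose pderiv_mult poly_pcompose poly_monom pderiv_monom del: power_Suc)
    from arg_cong[OF this, of norm] show ?thesis
      by (simp add: norm_mult norm_power w1 mult_ac del: power_Suc)
  qed
  then have "(\<Prod>w\<in>proots r. ?g (w ^ (q ^ Suc k)) * real q ^ Suc k)
    = (\<Prod>w\<in>proots r. ?g (w ^ (q ^ k)) * real q ^ k * norm (ipoly (Phi ?d) w))"
    by (intro prod.cong refl)
  then have "N * (real q ^ Suc k) ^ totient r
    = N * (real q ^ k) ^ totient r * norm (pnorm r (Phi ?d))"
    by (simp only: prod.distrib N prod_constant card_proots[OF assms(1)] pnorm_def prod_norm[symmetric])
  then have "(real q ^ k) ^ totient r * real q ^ totient r
    = (real q ^ k) ^ totient r * norm (pnorm r (Phi ?d))"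
    using N0 by (simp add: power_mult_distrib mult_ac)
  then show ?thesis using q by (simp add: i)
qed

section \<open>Multiplicities of cyclotomic factors\<close>

lemma norm_ipoly_le:
  assumes "norm w = 1"
  shows "norm (ipoly F w) \<le> of_int (poly_norm F)"
proof -
  have "norm (ipoly F w) \<le> (\<Sum>i\<le>degree F. norm (of_int (coeff F i) * w ^ i))"
    unfolding poly_altdef degree_cpoly coeff_cpoly by (rule norm_sum)
  also have "\<dots> = of_int (poly_norm F)"
    by (simp add: poly_norm_def norm_mult norm_power assms)
  finally show ?thesis .
qed

lemma poly_norm_nonneg: "poly_norm F \<ge> 0"
  by (simp add: poly_norm_def sum_nonneg)

lemma poly_norm_pderiv_le: "poly_norm (pderiv F) \<le> int (degree F) * poly_norm F"
proof (cases "degree F")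
  case 0
  then have "pderiv F = 0" by (simp add: pderiv_eq_0_iff)
  then show ?thesis by (simp add: poly_norm_def 0)
next
  case (Suc N)
  have "poly_norm (pderiv F) = (\<Sum>i\<le>N. int (Suc i) * \<bar>coeff F (Suc i)\<bar>)"
    by (simp add: poly_norm_def degree_pderiv Suc coeff_pderiv abs_mult del: of_nat_Suc)
  also have "\<dots> \<le> (\<Sum>i\<le>N. int (Suc N) * \<bar>coeff F (Suc i)\<bar>)"
    by (intro sum_mono mult_right_mono) auto
  also have "\<dots> = int (Suc N) * (\<Sum>i\<le>N. \<bar>coeff F (Suc i)\<bar>)" by (simp add: sum_distrib_left)
  also have "\<dots> \<le> int (Suc N) * poly_norm F"
    unfolding poly_norm_def Suc sum.atMost_Suc_shift by (intro mult_left_mono) auto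
  finally show ?thesis by (simp add: Suc)
qed

lemma poly_norm_higher_pderiv_le:
  "poly_norm ((pderiv ^^ a) F) \<le> int (degree F) ^ a * poly_norm F"
proof (induction a)
  case (Suc a)
  let ?G = "(pderiv ^^ a) F"
  have "poly_norm (pderiv ?G) \<le> int (degree ?G) * poly_norm ?G" by (rule poly_norm_pderiv_le)
  also have "\<dots> \<le> int (degree F) * (int (degree F) ^ a * poly_norm F)"
    using Suc by (intro mult_mono) (auto simp: degree_higher_pderiv poly_norm_nonneg)
  finally show ?case by (simp add: mult_ac)
qed simp

text \<open>One differentiation of a product with \<open>Suc a\<close> linear factors leaves
  \<open>a\<close> of them and a cofactor with value \<open>Suc a * poly G w\<close> at
  \<open>w\<close>. The cofactor changes at each stage, hence the generalization over
  \<open>G\<close>.\<close>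

lemma poly_higher_pderiv_root:
  fixes w :: "'a :: field_char_0"
  shows "poly ((pderiv ^^ a) ([:-w, 1:] ^ a * G)) w = fact a * poly G w"
proof (induction a arbitrary: G)
  case (Suc a)
  have "pderiv [:-w, 1:] = 1" by (simp add: pderiv_pCons one_pCons)
  then have L: "pderiv ([:-w, 1:] ^ Suc a) = smult (of_nat (Suc a)) ([:-w, 1:] ^ a)"
    unfolding pderiv_power_Suc by simp
  have "pderiv ([:-w, 1:] ^ Suc a * G)
    = [:-w, 1:] ^ a * (smult (of_nat (Suc a)) G + [:-w, 1:] * pderiv G)"
    unfolding pderiv_mult L
    by (simp add: algebra_simps del: mult_pCons_left mult_pCons_right of_nat_Suc)
  then have "poly ((pderiv ^^ Suc a) ([:-w, 1:] ^ Suc a * G)) w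
    = fact a * poly (smult (of_nat (Suc a)) G + [:-w, 1:] * pderiv G) w"
    unfolding funpow_Suc_right comp_def using Suc.IH by presburger
  then show ?case by (simp add: algebra_simps)
qed simp

lemma cpoly_higher_pderiv: "cpoly ((pderiv ^^ a) F) = (pderiv ^^ a) (cpoly F)"
  by (induction a) auto

lemma prime_elem_dvd_prodE:
  assumes "finite T" "prime_elem p" "p dvd prod f T"
  obtains t where "t \<in> T" "p dvd f t"
  using assms
proof (induction T arbitrary: thesis rule: finite_induct)
  case (insert t T)
  then have "p dvd f t \<or> p dvd prod f T" using prime_elem_dvd_multD by fastforce
  then show ?case using insert by blast
qed (auto simp: prime_elem_def)

text \<open>The condition on \<open>P s dvd P t\<close> makes the primes pairwise nonassociated. In
  the induction the new prime does not divide the product so far, so its whole power divides the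
  cofactor \<open>K\<close>.\<close>

lemma prod_power_multiplicity_dvd:
  fixes F :: "'a :: factorial_semiring"
  assumes "finite T" "\<And>t. t \<in> T \<Longrightarrow> prime_elem (P t)"
    and "\<And>s t. s \<in> T \<Longrightarrow> t \<in> T \<Longrightarrow> P s dvd P t \<Longrightarrow> s = t" and "F \<noteq> 0"
  shows "(\<Prod>t\<in>T. P t ^ multiplicity (P t) F) dvd F"
  using assms
proof (induction T rule: finite_induct)
  case (insert t T)
  let ?A = "\<Prod>t\<in>T. P t ^ multiplicity (P t) F"
  obtain K where K: "F = ?A * K" using insert by (auto elim!: dvdE)
  have "\<not> P t dvd ?A"
  proof
    assume "P t dvd ?A"
    then obtain s where s: "s \<in> T" "P t dvd P s ^ multiplicity (P s) F"
      using prime_elem_dvd_prodE insert.hyps insert.prems(1)[of t] by blast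
    then have "P t dvd P s" using insert.prems(1)[of t] prime_elem_dvd_power by blast
    then show False using insert.prems(2)[of t s] insert.hyps s by auto
  qed
  have "P t ^ multiplicity (P t) F dvd ?A * K"
    unfolding K[symmetric] by (rule multiplicity_dvd)
  then obtain x y where xy: "x + y = multiplicity (P t) F" "P t ^ x dvd ?A" "P t ^ y dvd K"
    using prime_elem_power_dvd_prod insert.prems(1)[of t] by blast
  have "x = 0"
  proof (rule ccontr)
    assume "x \<noteq> 0"
    then have "P t dvd P t ^ x" by simp
    then show False using xy(2) \<open>\<not> P t dvd ?A\<close> dvd_trans by blast
  qed
  then have "P t ^ multiplicity (P t) F dvd K" using xy by simp
  then have "P t ^ multiplicity (P t) F * ?A dvd K * ?A" by (rule mult_dvd_mono) simp
  also have "K * ?A = F" using K by (simp add: mult.commute)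
  finally have "P t ^ multiplicity (P t) F * ?A dvd F" .
  then show ?case using insert.hyps by simp
qed simp

lemma norm_cyclotomic_cofactor_le:
  assumes "r > 0" "F = Phi r ^ a * G"
  shows "norm (pnorm r G) \<le> (real (degree F) ^ a * of_int (poly_norm F)) ^ totient r"
proof -
  let ?B = "real (degree F) ^ a * of_int (poly_norm F)"
  have bound: "norm (ipoly (pderiv (Phi r)) w) ^ a * norm (ipoly G w) \<le> ?B" if w: "w \<in> proots r" for w
  proof -
    have "ipoly (Phi r) w = 0" using w assms(1) by (simp add: ipoly_Phi_eq_0_iff)
    then obtain S where S: "cpoly (Phi r) = [:-w, 1:] * S"
      by (auto simp: poly_eq_0_iff_dvd elim: dvdE)
    have P': "ipoly (pderiv (Phi r)) w = poly S w"
      unfolding cpoly_pderiv S by (simp add: pderiv_mult pderiv_pCons del: mult_pCons_left)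
    have "cpoly F = [:-w, 1:] ^ a * (S ^ a * cpoly G)"
      by (simp add: assms(2) S power_mult_distrib mult.assoc del: mult_pCons_left)
    then have "ipoly ((pderiv ^^ a) F) w = fact a * (poly S w ^ a * ipoly G w)"
      unfolding cpoly_higher_pderiv using poly_higher_pderiv_root[of a w "S ^ a * cpoly G"] by simp
    then have "fact a * (norm (poly S w) ^ a * norm (ipoly G w)) = norm (ipoly ((pderiv ^^ a) F) w)"
      by (simp add: norm_mult norm_power)
    also have "\<dots> \<le> of_int (poly_norm ((pderiv ^^ a) F))"
      using norm_ipoly_le norm_proots assms(1) w by blast
    also have "\<dots> \<le> of_int (int (degree F) ^ a * poly_norm F)"
      using poly_norm_higher_pderiv_le by (simp only: of_int_le_iff)
    finally have *: "fact a * (norm (poly S w) ^ a * norm (ipoly G w)) \<le> ?B" by simp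
    have "1 * (norm (poly S w) ^ a * norm (ipoly G w)) \<le> fact a * (norm (poly S w) ^ a * norm (ipoly G w))"
      by (intro mult_right_mono) (auto simp: fact_ge_1)
    with * show ?thesis unfolding P' by linarith
  qed
  have "\<not> Phi r dvd pderiv (Phi r)" using assms(1) by (simp add: degree_Phi)
  then have "1 \<le> norm (pnorm r (pderiv (Phi r)))"
    using norm_pnorm_ge_1[OF assms(1)] by blast
  then have "1 * norm (pnorm r G) \<le> norm (pnorm r (pderiv (Phi r))) ^ a * norm (pnorm r G)"
    by (intro mult_right_mono one_le_power) auto
  also have "\<dots> = (\<Prod>w\<in>proots r. norm (ipoly (pderiv (Phi r)) w) ^ a * norm (ipoly G w))"
    by (simp only: pnorm_def prod.distrib prod_power_distrib prod_norm[symmetric])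
  also have "\<dots> \<le> (\<Prod>w\<in>proots r. ?B)"
    by (intro prod_mono) (use bound in auto)
  also have "\<dots> = ?B ^ totient r" by (simp add: card_proots assms(1))
  finally show ?thesis by simp
qed

text \<open>Distinct pairs give distinct orders, so the corresponding cyclotomic powers divide the
  cofactor \<open>G\<close> together. The remaining factor \<open>K\<close> has norm at least 1.
  Both sides are then \<open>totient r\<close>-th powers, and the root can be taken.\<close>

lemma prod_primes_power_multiplicity_le:
  fixes F :: "int poly"
  assumes "r > 0" "F \<noteq> 0" "finite T"
    and T: "\<And>q i. (q, i) \<in> T \<Longrightarrow> prime q \<and> \<not> q dvd r \<and> i > 0"
  shows "(\<Prod>(q, i)\<in>T. real q ^ multiplicity (Phi (r * q ^ i)) F)
    \<le> real (degree F) ^ multiplicity (Phi r) F * of_int (poly_norm F)"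
proof -
  define a where "a = multiplicity (Phi r) F"
  define d where "d = (\<lambda>(q, i). r * q ^ i :: nat)"
  have "\<not> is_unit (Phi r)" using prime_elem_Phi[OF assms(1)] by simp
  then obtain G where G: "F = Phi r ^ a * G" "\<not> Phi r dvd G"
    using multiplicity_decompose'[of F "Phi r"] assms(2) unfolding a_def by metis
  have G0: "G \<noteq> 0" using G(2) by auto
  have d0: "d t > 0" if "t \<in> T" for t
    using that T assms(1) by (cases t) (auto simp: d_def prime_gt_0_nat)
  have d_inj: "s = t" if st: "s \<in> T" "t \<in> T" "d s = d t" for s t
  proof -
    obtain p i q j where [simp]: "s = (p, i)" "t = (q, j)" by fastforce
    have pq: "p ^ i = q ^ j" "prime p" "prime q" "i > 0"
      using st assms(1) T[of p i] T[of q j] by (auto simp: d_def)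
    then have "p = q" using prime_power_eq_imp_eq by blast
    then show ?thesis using pq prime_gt_1_nat[of q] by auto
  qed
  have d_ne: "d t \<noteq> r" if t: "t \<in> T" for t
  proof -
    obtain q i where [simp]: "t = (q, i)" by fastforce
    have "q ^ i > 1" using T[of q i] t prime_gt_1_nat[of q] one_less_power[of q i] by simp
    then show ?thesis using assms(1) by (cases "i = 0") (auto simp: d_def)
  qed
  have mult_eq: "multiplicity (Phi (d t)) F = multiplicity (Phi (d t)) G" if t: "t \<in> T" for t
  proof -
    have "\<not> Phi (d t) dvd Phi r" using Phi_dvd_Phi_imp_eq d0 d_ne t assms(1) by blast
    then have "multiplicity (Phi (d t)) (Phi r) = 0" by (rule not_dvd_imp_multiplicity_0)
    then show ?thesis
      using prime_elem_Phi[OF d0[OF t]] Phi_nonzero[OF assms(1)] G0 unfolding G(1)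
      by (simp add: prime_elem_multiplicity_mult_distrib prime_elem_multiplicity_power_distrib)
  qed
  have "(\<Prod>t\<in>T. Phi (d t) ^ multiplicity (Phi (d t)) G) dvd G"
  proof (rule prod_power_multiplicity_dvd)
    show "s = t" if st: "s \<in> T" "t \<in> T" "Phi (d s) dvd Phi (d t)" for s t
      using d_inj[OF st(1,2)] Phi_dvd_Phi_imp_eq[OF d0[OF st(1)] d0[OF st(2)] st(3)] by simp
  qed (use assms(3) G0 prime_elem_Phi[OF d0] in simp_all)
  then obtain K where K: "G = (\<Prod>t\<in>T. Phi (d t) ^ multiplicity (Phi (d t)) G) * K" by (elim dvdE)
  have "\<not> Phi r dvd K"
  proof
    assume "Phi r dvd K"
    then have "Phi r dvd (\<Prod>t\<in>T. Phi (d t) ^ multiplicity (Phi (d t)) G) * K" by (rule dvd_mult)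
    then show False using G(2) unfolding K[symmetric] by contradiction
  qed
  have P: "norm (pnorm r (Phi (d t))) = real (fst t) ^ totient r" if "t \<in> T" for t
    using norm_pnorm_Phi_prime_power[OF assms(1)] T that by (cases t) (auto simp: d_def)
  let ?L = "\<Prod>t\<in>T. real (fst t) ^ multiplicity (Phi (d t)) F"
  have "?L ^ totient r = (\<Prod>t\<in>T. norm (pnorm r (Phi (d t))) ^ multiplicity (Phi (d t)) G)"
    unfolding prod_power_distrib by (intro prod.cong refl) (simp add: P mult_eq mult.commute flip: power_mult)
  also have "\<dots> * norm (pnorm r K) = norm (pnorm r G)"
    by (subst (2) K) (simp add: pnorm_mult pnorm_prod pnorm_power norm_mult norm_power flip: prod_norm)
  finally have LK: "?L ^ totient r * norm (pnorm r K) = norm (pnorm r G)" .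
  have "?L ^ totient r * 1 \<le> ?L ^ totient r * norm (pnorm r K)"
    using norm_pnorm_ge_1[OF assms(1) \<open>\<not> Phi r dvd K\<close>] by (intro mult_left_mono zero_le_power prod_nonneg) auto
  also have "\<dots> \<le> (real (degree F) ^ a * of_int (poly_norm F)) ^ totient r"
    unfolding LK by (rule norm_cyclotomic_cofactor_le[OF assms(1) G(1)])
  finally have "?L ^ totient r \<le> (real (degree F) ^ a * of_int (poly_norm F)) ^ totient r" by simp
  then have "?L \<le> real (degree F) ^ a * of_int (poly_norm F)"
    using assms(1) by (subst (asm) power_mono_iff) (auto intro!: prod_nonneg simp: poly_norm_nonneg)
  moreover have "?L = (\<Prod>(q, i)\<in>T. real q ^ multiplicity (Phi (r * q ^ i)) F)"
    by (intro prod.cong) (auto simp: d_def)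
  ultimately show ?thesis by (simp add: a_def)
qed

text \<open>The bound \<open>n\<close> is later the degree of the whole product, which exceeds that
  of \<open>f\<close>. From \<open>n_ge_3\<close> follows \<open>ln n >= 1\<close>; a positive
  \<open>C\<close> starts the multiplicative induction in \<open>mu_le_prod\<close>.\<close>

locale bounded_norm_poly =
  fixes f :: "int poly" and n :: nat and C :: real
  assumes f1: "poly f 1 \<noteq> 0"
    and degree_f: "degree f \<le> n"
    and norm_f: "of_int (poly_norm f) \<le> real n powr C"
    and n_ge_3: "n \<ge> 3"
    and C_pos: "C > 0"
begin

definition mu :: "nat \<Rightarrow> nat" where
  "mu r = multiplicity (Phi r) f"

definition D :: "nat set" where
  "D = {d. d > 0 \<and> Phi d dvd f}"

lemma f_nonzero: "f \<noteq> 0"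
  using f1 by auto

lemma ln_n_ge_1: "ln (real n) \<ge> 1"
proof -
  have "exp 1 \<le> real n" using exp_le n_ge_3 by linarith
  then show ?thesis using n_ge_3 by (subst ln_ge_iff) auto
qed

lemma mu_1: "mu 1 = 0"
proof -
  have one: "1 \<in> proots 1" by (simp add: proots_def)
  have "ipoly f 1 = of_int (poly f 1)" by (simp add: poly_altdef)
  then have "\<not> Phi 1 dvd f" using ipoly_eq_0_iff_Phi_dvd[OF _ one, of f] f1 by simp
  then show ?thesis unfolding mu_def by (rule not_dvd_imp_multiplicity_0)
qed

lemma mu_pos_iff:
  assumes "d > 0"
  shows "mu d > 0 \<longleftrightarrow> d \<in> D"
proof -
  have "mu d = 0 \<longleftrightarrow> \<not> Phi d dvd f"
    unfolding mu_def by (rule prime_elem_multiplicity_eq_zero_iff[OF prime_elem_Phi[OF assms] f_nonzero])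
  then show ?thesis using assms by (auto simp: D_def)
qed

lemma sum_mu_ln_le:
  assumes "r > 0" "finite T"
    and T: "\<And>q i. (q, i) \<in> T \<Longrightarrow> prime q \<and> \<not> q dvd r \<and> i > 0"
  shows "(\<Sum>(q, i)\<in>T. mu (r * q ^ i) * ln (real q)) \<le> (mu r + C) * ln (real n)"
proof -
  have q: "real (fst t) > 0" if "t \<in> T" for t
    using T[of "fst t" "snd t"] that by (simp add: prime_gt_0_nat)
  have "(\<Sum>(q, i)\<in>T. mu (r * q ^ i) * ln (real q)) = (\<Sum>(q, i)\<in>T. ln (real q ^ mu (r * q ^ i)))"
    using q by (intro sum.cong refl) (auto simp: ln_realpow)
  also have "\<dots> = ln (\<Prod>(q, i)\<in>T. real q ^ mu (r * q ^ i))"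
    using q by (subst ln_prod) (auto simp: case_prod_unfold assms(2))
  also have "\<dots> \<le> ln (real n powr (mu r + C))"
  proof (subst ln_le_cancel_iff)
    show "(\<Prod>(q, i)\<in>T. real q ^ mu (r * q ^ i)) > 0"
      using q by (intro prod_pos) (auto simp: case_prod_unfold)
    show "real n powr (mu r + C) > 0" using n_ge_3 by simp
    have "(\<Prod>(q, i)\<in>T. real q ^ mu (r * q ^ i)) \<le> real (degree f) ^ mu r * of_int (poly_norm f)"
      unfolding mu_def using prod_primes_power_multiplicity_le[OF assms(1) f_nonzero assms(2) T] .
    also have "\<dots> \<le> real n ^ mu r * real n powr C"
      using degree_f norm_f by (intro mult_mono power_mono) (auto simp: poly_norm_nonneg)
    also have "\<dots> = real n powr (mu r + C)"
      using n_ge_3 by (simp add: powr_add powr_realpow)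
    finally show "(\<Prod>(q, i)\<in>T. real q ^ mu (r * q ^ i)) \<le> real n powr (mu r + C)" .
  qed
  finally show ?thesis using n_ge_3 by (simp add: ln_powr)
qed

text \<open>Removing the full power of one prime \<open>q\<close> from \<open>r\<close> leaves
  \<open>s\<close> with \<open>mu r * ln q <= (mu s + C) * ln n\<close>. As \<open>q <= n\<close>,
  also \<open>C * ln q <= (mu s + C) * ln n\<close>. Adding the two produces the factor 2, and
  bounding \<open>mu r + C\<close> instead of \<open>mu r\<close> makes the recursion purely
  multiplicative.\<close>

lemma mu_le_prod:
  assumes "r > 0" "\<And>q. q \<in> prime_factors r \<Longrightarrow> q \<le> n"
  shows "mu r + C \<le> C * (\<Prod>q\<in>prime_factors r. 2 * ln (real n) / ln (real q))"
  using assms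
proof (induction r rule: less_induct)
  case (less r)
  show ?case
  proof (cases "r = 1")
    case True
    then show ?thesis by (simp add: mu_1[simplified])
  next
    case False
    then obtain q where q: "prime q" "q dvd r" using prime_factor_nat by blast
    have q1: "q > 1" using q(1) by (rule prime_gt_1_nat)
    have "\<not> is_unit q" using q(1) not_prime_unit by blast
    then obtain s where s: "r = q ^ multiplicity q r * s" "\<not> q dvd s"
      using multiplicity_decompose'[of r q] less.prems(1) by auto
    define i where "i = multiplicity q r"
    have i: "i > 0" using q less.prems(1) by (simp add: i_def prime_multiplicity_gt_zero_iff)
    have rs: "r = s * q ^ i" using s(1) by (simp add: i_def mult.commute)
    have s0: "s > 0" using rs less.prems(1) by (cases s) auto
    have "1 < q ^ i" using q1 i by (rule one_less_power)
    then have "s < r" using s0 rs by simp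
    have pf: "prime_factors r = insert q (prime_factors s)"
      unfolding rs using s0 q i
      by (subst prime_factors_product) (auto simp: prime_factors_power prime_prime_factors)
    have "q \<notin> prime_factors s" using s(2) by auto
    have IH: "mu s + C \<le> C * (\<Prod>q\<in>prime_factors s. 2 * ln (real n) / ln (real q))"
      using less.IH[OF \<open>s < r\<close> s0] less.prems(2) pf by auto
    have lnq: "ln (real q) > 0" "ln (real q) \<le> ln (real n)"
      using q1 less.prems(2)[of q] pf by auto
    have "(\<Sum>(q, i)\<in>{(q, i)}. mu (s * q ^ i) * ln (real q)) \<le> (mu s + C) * ln (real n)"
      by (rule sum_mu_ln_le[OF s0]) (use q s i in auto)
    then have "mu r * ln (real q) \<le> (mu s + C) * ln (real n)" by (simp add: rs)
    moreover have "C * ln (real q) \<le> (mu s + C) * ln (real n)"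
      using lnq C_pos by (intro mult_mono) auto
    ultimately have "(mu r + C) * ln (real q) \<le> (mu s + C) * (2 * ln (real n))"
      by (simp add: algebra_simps)
    then have "mu r + C \<le> (mu s + C) * (2 * ln (real n) / ln (real q))"
      using lnq by (simp add: field_simps)
    also have "\<dots> \<le> C * (\<Prod>q\<in>prime_factors s. 2 * ln (real n) / ln (real q)) * (2 * ln (real n) / ln (real q))"
      using IH lnq by (intro mult_right_mono) auto
    also have "\<dots> = C * (\<Prod>q\<in>prime_factors r. 2 * ln (real n) / ln (real q))"
      unfolding pf using \<open>q \<notin> prime_factors s\<close> by simp
    finally show ?thesis .
  qed
qed

text \<open>With one exponent chosen for each prime, every term of the sum in
  \<open>sum_mu_ln_le\<close> has multiplicity at least 1 and logarithm at least
  \<open>ln 2\<close>.\<close>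

lemma card_primes_le:
  assumes "r > 0" "finite S"
    and S: "\<And>p. p \<in> S \<Longrightarrow> prime p \<and> \<not> p dvd r \<and> (\<exists>i>0. r * p ^ i \<in> D)"
  shows "card S * ln 2 \<le> (mu r + C) * ln (real n)"
proof -
  obtain i where i: "\<And>p. p \<in> S \<Longrightarrow> i p > 0 \<and> r * p ^ i p \<in> D" using S by metis
  let ?T = "(\<lambda>p. (p, i p)) ` S"
  have inj: "inj_on (\<lambda>p. (p, i p)) S" by (auto intro: inj_onI)
  have "card S * ln 2 = (\<Sum>p\<in>S. ln 2)" by simp
  also have "\<dots> \<le> (\<Sum>p\<in>S. mu (r * p ^ i p) * ln (real p))"
  proof (rule sum_mono)
    fix p assume p: "p \<in> S"
    have p2: "p \<ge> 2" using S[OF p] prime_ge_2_nat by blast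
    have "r * p ^ i p > 0" using i[OF p] unfolding D_def by blast
    then have "mu (r * p ^ i p) > 0" using i[OF p] mu_pos_iff by blast
    then have "1 \<le> mu (r * p ^ i p)" by linarith
    then have "1 * ln 2 \<le> real (mu (r * p ^ i p)) * ln (real p)"
      using p2 by (intro mult_mono) auto
    then show "ln 2 \<le> real (mu (r * p ^ i p)) * ln (real p)" by simp
  qed
  also have "\<dots> = (\<Sum>(q, i)\<in>?T. mu (r * q ^ i) * ln (real q))"
    by (simp add: sum.reindex[OF inj] case_prod_unfold)
  also have "\<dots> \<le> (mu r + C) * ln (real n)"
    by (rule sum_mu_ln_le) (use assms i in auto)
  finally show ?thesis .
qed

text \<open>The product of the cyclotomic factors with their multiplicities divides
  \<open>f\<close>. This yields the finiteness of \<open>D\<close> and limits the number of orders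
  with large totient.\<close>

lemma sum_totient_le:
  assumes "finite E" "E \<subseteq> D"
  shows "(\<Sum>d\<in>E. totient d) \<le> n"
proof -
  have pos: "d > 0" if "d \<in> E" for d using that assms by (auto simp: D_def)
  have "(\<Sum>d\<in>E. totient d) \<le> (\<Sum>d\<in>E. mu d * totient d)"
  proof (rule sum_mono)
    fix d assume "d \<in> E"
    then have "mu d > 0" using mu_pos_iff[OF pos] assms by blast
    then show "totient d \<le> mu d * totient d" by simp
  qed
  also have "\<dots> = degree (\<Prod>d\<in>E. Phi d ^ mu d)"
    using pos Phi_nonzero
    by (subst degree_prod_eq_sum_degree) (auto simp: degree_power_eq degree_Phi intro!: sum.cong)
  also have "\<dots> \<le> degree f"
  proof (rule dvd_imp_degree_le[OF _ f_nonzero])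
    show "(\<Prod>d\<in>E. Phi d ^ mu d) dvd f"
      unfolding mu_def using assms(1) f_nonzero prime_elem_Phi pos
      by (intro prod_power_multiplicity_dvd) (simp_all add: Phi_dvd_Phi_imp_eq)
  qed
  finally show ?thesis using degree_f by simp
qed

lemma finite_D: "finite D"
proof (rule ccontr)
  assume "infinite D"
  then obtain E where E: "finite E" "card E = Suc n" "E \<subseteq> D"
    using infinite_arbitrarily_large by blast
  have "card E = (\<Sum>d\<in>E. 1)" by simp
  also have "\<dots> \<le> (\<Sum>d\<in>E. totient d)"
    using E by (intro sum_mono) (auto simp: D_def Suc_le_eq)
  also have "\<dots> \<le> n" using sum_totient_le E by blast
  finally show False using E by simp
qed

lemma totient_le_n: "d \<in> D \<Longrightarrow> totient d \<le> n"
  using sum_totient_le[of "{d}"] by simp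

end

section \<open>Sums over prime factorizations\<close>

text \<open>Telescoping: for \<open>q > 2\<close> each term is at most
  \<open>ln (ln q) - ln (ln (q - 1))\<close>, by two uses of \<open>ln x <= x - 1\<close>. The
  constant 2 absorbs the term at 2 and the negative \<open>ln (ln 2)\<close>, both controlled by
  \<open>1 / ln 2 <= 3 / 2\<close>.\<close>

lemma sum_inverse_mult_ln_le:
  assumes "M \<ge> 2"
  shows "(\<Sum>q=2..M. 1 / (real q * ln (real q))) \<le> ln (ln (real M)) + 2"
  using assms
proof (induction M rule: dec_induct)
  case base
  have l: "2 / 3 \<le> ln (2::real)" by (rule ln2_ge_two_thirds)
  have "ln (1 / ln (2::real)) \<le> 1 / ln 2 - 1" by (rule ln_le_minus_one) simp
  moreover have "1 / ln (2::real) \<le> 3 / 2" using l by (simp add: field_simps)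
  ultimately show ?case by (simp add: ln_div field_simps)
next
  case (step M)
  let ?a = "ln (real M)" and ?b = "ln (real (Suc M))"
  have a: "?a > 0" and ab: "?a < ?b" using step.hyps by auto
  then have b: "?b > 0" by linarith
  have "1 / real (Suc M) \<le> ?b - ?a"
  proof -
    have "ln (real M / real (Suc M)) \<le> real M / real (Suc M) - 1"
      using step.hyps by (intro ln_le_minus_one) auto
    also have "\<dots> = - (1 / real (Suc M))" by (simp add: field_simps)
    finally show ?thesis using step.hyps by (simp add: ln_div)
  qed
  then have "1 / real (Suc M) / ?b \<le> (?b - ?a) / ?b"
    using a ab by (intro divide_right_mono) auto
  then have "1 / (real (Suc M) * ?b) \<le> (?b - ?a) / ?b" by (simp only: divide_divide_eq_left)
  also have "\<dots> = 1 - ?a / ?b" using b by (simp add: diff_divide_distrib)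
  also have "\<dots> \<le> - ln (?a / ?b)" using ln_le_minus_one[OF divide_pos_pos[OF a b]] by linarith
  also have "\<dots> = ln ?b - ln ?a" using a b by (simp add: ln_div)
  finally show ?case using step by simp
qed

section \<open>Number of prime factors against the totient\<close>

lemma fact_card_le_prod:
  fixes A :: "nat set"
  assumes "finite A" "0 \<notin> A"
  shows "fact (card A) \<le> \<Prod>A"
  using assms
proof (induction A rule: finite_linorder_max_induct)
  case (insert b A)
  have "A \<subseteq> {1..<b}" using insert by (auto simp: Suc_le_eq intro: gr0I)
  then have "card A \<le> card {1..<b}" by (intro card_mono) auto
  then have "Suc (card A) \<le> b" using insert.prems by auto
  moreover have "fact (card A) \<le> \<Prod>A" using insert by simp
  ultimately have "Suc (card A) * fact (card A) \<le> b * \<Prod>A" by (rule mult_le_mono)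
  moreover have "b \<notin> A" using insert by auto
  ultimately show ?case using insert.hyps by (simp del: mult_Suc)
qed simp

text \<open>The numbers \<open>q - 1\<close> are distinct and positive, so their product is at least
  the factorial of their number, and each appears as a factor in the totient formula.\<close>

lemma fact_card_prime_factors_le_totient:
  assumes "r > 0"
  shows "fact (card (prime_factors r)) \<le> totient r"
proof -
  let ?A = "(\<lambda>q. q - 1) ` prime_factors r"
  have inj: "inj_on (\<lambda>q. q - 1) (prime_factors r)"
    by (intro inj_onI) (metis One_nat_def Suc_pred in_prime_factors_iff prime_gt_0_nat)
  have "q - 1 > 0" if "q \<in> prime_factors r" for q
    using that prime_gt_1_nat[of q] by (auto simp: in_prime_factors_iff)
  then have "fact (card ?A) \<le> \<Prod>?A" by (intro fact_card_le_prod) force+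
  also have "\<Prod>?A = (\<Prod>q\<in>prime_factors r. q - 1)" by (simp only: prod.reindex[OF inj] comp_def)
  also have "\<dots> \<le> (\<Prod>q\<in>prime_factors r. q ^ (multiplicity q r - 1) * (q - 1))"
  proof (rule prod_mono)
    fix q assume "q \<in> prime_factors r"
    then have "1 \<le> q ^ (multiplicity q r - 1)"
      by (auto simp: in_prime_factors_iff prime_gt_0_nat Suc_le_eq)
    then show "0 \<le> q - 1 \<and> q - 1 \<le> q ^ (multiplicity q r - 1) * (q - 1)" by simp
  qed
  also have "\<dots> = totient r" by (rule totient_formula1[OF assms, symmetric])
  finally show ?thesis by (simp only: card_image[OF inj])
qed

lemma power_le_fact_exp:
  fixes x :: real
  assumes "x \<ge> 0"
  shows "x ^ k \<le> fact k * exp x"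
proof -
  have "(\<lambda>k. x ^ k /\<^sub>R fact k) sums exp x" by (rule exp_converges)
  then have "summable (\<lambda>k. x ^ k /\<^sub>R fact k)" "exp x = (\<Sum>k. x ^ k /\<^sub>R fact k)"
    by (simp_all add: sums_iff)
  then have "(\<Sum>i\<in>{k}. x ^ i /\<^sub>R fact i) \<le> exp x"
    using sum_le_suminf[of "\<lambda>k. x ^ k /\<^sub>R fact k" "{k}"] assms by simp
  then show ?thesis by (simp add: field_simps)
qed

text \<open>In \<open>power_le_fact_exp\<close> with \<open>x = ln n\<close> the exponential equals
  \<open>n\<close>, and the factorial is at most \<open>totient r\<close>, hence at most
  \<open>n\<close>.\<close>

lemma ln_power_card_prime_factors_le:
  assumes "r > 0" "totient r \<le> n" "n > 0"
  shows "ln (real n) ^ card (prime_factors r) \<le> real n ^ 2"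
proof -
  let ?s = "card (prime_factors r)"
  have "fact ?s \<le> n" using fact_card_prime_factors_le_totient[OF assms(1)] assms(2) by (rule le_trans)
  then have "fact ?s \<le> real n" by (metis of_nat_fact of_nat_le_iff)
  have "ln (real n) ^ ?s \<le> fact ?s * exp (ln (real n))"
    using assms(3) by (intro power_le_fact_exp) auto
  also have "\<dots> \<le> real n * real n"
    using \<open>fact ?s \<le> real n\<close> assms(3) by (intro mult_mono) auto
  finally show ?thesis by (simp add: power2_eq_square)
qed

text \<open>Each \<open>r\<close> is determined by its vector of exponents at the primes up to
  \<open>M\<close>. Summing over all vectors with entries up to a common bound \<open>E\<close>
  gives a product of sums, the Euler product, and \<open>1 + U <= exp U\<close> turns it into an
  exponential.\<close>

lemma sum_over_prime_factorizations_le: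
  fixes u :: "nat \<Rightarrow> nat \<Rightarrow> real" and U :: "nat \<Rightarrow> real"
  assumes "finite R" "0 \<notin> R"
    and R: "\<And>r q. r \<in> R \<Longrightarrow> q \<in> prime_factors r \<Longrightarrow> q \<le> M"
    and u: "\<And>q e. prime q \<Longrightarrow> u q e \<ge> 0"
    and U: "\<And>q E. prime q \<Longrightarrow> (\<Sum>e=1..E. u q e) \<le> U q"
  shows "(\<Sum>r\<in>R. \<Prod>q\<in>prime_factors r. u q (multiplicity q r)) \<le> exp (\<Sum>q | prime q \<and> q \<le> M. U q)"
proof -
  let ?P = "{q. prime q \<and> q \<le> M}"
  have finP: "finite ?P" by simp
  have "finite (\<Union>r\<in>R. (\<lambda>q. multiplicity q r) ` prime_factors r)" using assms(1) by simp
  then obtain E where E: "\<And>r q. r \<in> R \<Longrightarrow> q \<in> prime_factors r \<Longrightarrow> multiplicity q r \<le> E"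
    unfolding finite_nat_set_iff_bounded_le by blast
  \<comment> \<open>Exponent 0 gets weight 1, so that primes not dividing \<open>r\<close> leave the
    product unchanged.\<close>
  define v where "v = (\<lambda>q e. if e = 0 then 1 else u q e)"
  have v0: "v q e \<ge> 0" if "prime q" for q e using u[OF that] by (simp add: v_def)
  define h where "h = (\<lambda>r. restrict (\<lambda>q. multiplicity q r) ?P)"
  have mult0: "multiplicity q r = 0" if "r \<in> R" "prime q" "q \<notin> prime_factors r" for q r
    using that assms(2) by (auto simp: prime_factors_multiplicity)
  have inj: "inj_on h R"
  proof
    fix r s assume rs: "r \<in> R" "s \<in> R" "h r = h s"
    have "multiplicity q r = multiplicity q s" if q: "prime q" for q
    proof (cases "q \<le> M")
      case True
      then show ?thesis using fun_cong[OF rs(3), of q] q by (simp add: h_def)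
    next
      case False
      then show ?thesis using mult0 R rs q by metis
    qed
    then show "r = s" using rs assms(2) multiplicity_eq_nat[of r s] by (metis neq0_conv)
  qed
  have h_mem: "h ` R \<subseteq> PiE ?P (\<lambda>_. {0..E})"
  proof (intro image_subsetI)
    fix r assume r: "r \<in> R"
    have "multiplicity q r \<le> E" if "prime q" for q
      using E[OF r, of q] mult0[OF r that] by (cases "q \<in> prime_factors r") simp_all
    then show "h r \<in> PiE ?P (\<lambda>_. {0..E})" by (simp add: h_def restrict_PiE_iff)
  qed
  have "(\<Prod>q\<in>prime_factors r. u q (multiplicity q r)) = (\<Prod>q\<in>?P. v q (h r q))" if r: "r \<in> R" for r
  proof -
    have "(\<Prod>q\<in>?P. v q (h r q)) = (\<Prod>q\<in>prime_factors r. v q (h r q))"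
      using R[OF r] mult0[OF r] finP
      by (intro prod.mono_neutral_right) (auto simp: v_def h_def in_prime_factors_iff)
    also have "\<dots> = (\<Prod>q\<in>prime_factors r. u q (multiplicity q r))"
      using R[OF r] by (intro prod.cong refl) (auto simp: v_def h_def prime_factors_multiplicity)
    finally show ?thesis ..
  qed
  then have "(\<Sum>r\<in>R. \<Prod>q\<in>prime_factors r. u q (multiplicity q r)) = (\<Sum>r\<in>R. \<Prod>q\<in>?P. v q (h r q))"
    by (rule sum.cong[OF refl])
  also have "\<dots> = (\<Sum>g\<in>h ` R. \<Prod>q\<in>?P. v q (g q))" by (simp add: sum.reindex[OF inj])
  also have "\<dots> \<le> (\<Sum>g\<in>PiE ?P (\<lambda>_. {0..E}). \<Prod>q\<in>?P. v q (g q))"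
    using h_mem v0 finP by (intro sum_mono2 finite_PiE prod_nonneg) auto
  also have "\<dots> = (\<Prod>q\<in>?P. \<Sum>e=0..E. v q e)"
    using finP by (rule prod_sum_PiE[symmetric]) auto
  also have "\<dots> \<le> (\<Prod>q\<in>?P. exp (U q))"
  proof (rule prod_mono)
    fix q assume "q \<in> ?P"
    then have q: "prime q" by simp
    have "(\<Sum>e=0..E. v q e) = 1 + (\<Sum>e=1..E. u q e)"
      by (subst sum.atLeast_Suc_atMost) (auto simp: v_def intro!: sum.cong)
    also have "\<dots> \<le> 1 + U q" using U[OF q] by simp
    also have "\<dots> \<le> exp (U q)" by (rule exp_ge_add_one_self)
    finally show "0 \<le> (\<Sum>e=0..E. v q e) \<and> (\<Sum>e=0..E. v q e) \<le> exp (U q)"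
      using v0[OF q] by (simp add: sum_nonneg)
  qed
  also have "\<dots> = exp (\<Sum>q\<in>?P. U q)" using finP by (simp add: exp_sum)
  finally show ?thesis .
qed

text \<open>From \<open>q - 1 >= q / 2\<close> and \<open>q ^ e >= 2 ^ e\<close> the sum is at most
  \<open>2 / q\<close> times a geometric series with ratio one half.\<close>

lemma sum_inverse_totient_prime_power_le:
  assumes "prime q"
  shows "(\<Sum>e=1..E. 1 / real (q ^ (e - 1) * (q - 1))) \<le> 4 / real q"
proof -
  have q: "q \<ge> 2" using assms by (rule prime_ge_2_nat)
  have geo: "(\<Sum>e<E. (1 / 2 :: real) ^ e) \<le> 2"
    using sum_le_suminf[of "\<lambda>e. (1 / 2 :: real) ^ e" "{..<E}"] by (simp add: suminf_geometric)
  have "(\<Sum>e=1..E. 1 / real (q ^ (e - 1) * (q - 1))) = (\<Sum>e<E. 1 / real (q ^ e * (q - 1)))"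
    by (rule sum.reindex_bij_witness[of _ Suc "\<lambda>e. e - 1"]) auto
  also have "\<dots> \<le> (\<Sum>e<E. (1 / 2) ^ e * (2 / real q))"
  proof (rule sum_mono)
    fix e
    have "real q / 2 \<le> real (q - 1)" using q by (simp add: of_nat_diff)
    moreover have "(2::real) ^ e \<le> real q ^ e" using q by (intro power_mono) auto
    ultimately have "2 ^ e * (real q / 2) \<le> real q ^ e * real (q - 1)"
      using q by (intro mult_mono) auto
    then have "1 / (real q ^ e * real (q - 1)) \<le> 1 / (2 ^ e * (real q / 2))"
      using q by (intro divide_left_mono) auto
    then show "1 / real (q ^ e * (q - 1)) \<le> (1 / 2) ^ e * (2 / real q)"
      by (simp add: power_one_over field_simps)
  qed
  also have "\<dots> = (\<Sum>e<E. (1 / 2) ^ e) * (2 / real q)" by (rule sum_distrib_right[symmetric])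
  also have "\<dots> \<le> 2 * (2 / real q)" using geo by (intro mult_right_mono) auto
  finally show ?thesis by simp
qed

text \<open>The factor \<open>L ^ card (prime_factors r)\<close>, with \<open>L = ln n\<close>, is at most \<open>n ^ 2\<close> because
  \<open>(card (prime_factors r))!\<close> does not exceed \<open>totient r\<close>. Trading its \<open>\<eta>\<close>-th power for
  \<open>n powr (2 * \<eta>)\<close>, and bounding \<open>1\<close> by \<open>Y / totient r\<close> (Rankin's trick), leaves an Euler product
  over weights of order \<open>L powr (1 - \<eta>) / (q * ln q)\<close>, which is \<open>n powr o(1)\<close>.\<close>

lemma sum_prod_prime_factors_le:
  fixes Y \<eta> :: real
  assumes "finite R" "0 \<notin> R" "n \<ge> 3" "0 \<le> Y" "Y \<le> real n" "0 < \<eta>"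
    and tot: "\<And>r. r \<in> R \<Longrightarrow> real (totient r) \<le> Y"
    and R: "\<And>r q. r \<in> R \<Longrightarrow> q \<in> prime_factors r \<Longrightarrow> q \<le> n"
  defines "L \<equiv> ln (real n)"
  shows "(\<Sum>r\<in>R. \<Prod>q\<in>prime_factors r. 2 * L / ln (real q))
    \<le> real n powr (2 * \<eta>) * Y * exp (8 * L powr (1 - \<eta>) * (ln L + 2))"
proof -
  \<comment> \<open>Chosen so that \<open>2 * L = A * L powr \<eta>\<close>: the second factor is
    collected over all prime factors, the first stays in the Euler product.\<close>
  define A where "A = 2 * L powr (1 - \<eta>)"
  have L0: "L > 0" using assms(3) by (simp add: L_def)
  have A0: "A > 0" using L0 by (simp add: A_def)
  \<comment> \<open>For \<open>e > 0\<close> the last denominator is \<open>totient (q ^ e)\<close>,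
    so the product over the factorization of \<open>r\<close> carries exactly
    \<open>1 / totient r\<close>.\<close>
  define u where "u = (\<lambda>q e. A / ln (real q) * (1 / real (q ^ (e - 1) * (q - 1))))"
  have lnq: "ln (real q) > 0" if "prime q" for q
    using prime_gt_1_nat[OF that] by simp
  have u0: "u q e \<ge> 0" if "prime q" for q e
    using lnq[OF that] A0 by (simp add: u_def)
  have term_le: "(\<Prod>q\<in>prime_factors r. 2 * L / ln (real q))
    \<le> real n powr (2 * \<eta>) * Y * (\<Prod>q\<in>prime_factors r. u q (multiplicity q r))" if r: "r \<in> R" for r
  proof -
    have r0: "r > 0" using r assms(2) by (cases r) auto
    let ?s = "card (prime_factors r)"
    let ?B = "\<Prod>q\<in>prime_factors r. A / ln (real q)"
    have B0: "?B \<ge> 0" using lnq A0 by (intro prod_nonneg) (simp add: in_prime_factors_iff less_imp_le)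
    have "2 * L = A * L powr \<eta>" using L0 by (simp add: A_def flip: powr_add)
    then have "(\<Prod>q\<in>prime_factors r. 2 * L / ln (real q)) = (\<Prod>q\<in>prime_factors r. L powr \<eta> * (A / ln (real q)))"
      by (simp add: mult.commute)
    also have "\<dots> = (L powr \<eta>) ^ ?s * ?B" by (simp only: prod.distrib prod_constant)
    finally have eq: "(\<Prod>q\<in>prime_factors r. 2 * L / ln (real q)) = (L powr \<eta>) ^ ?s * ?B" .
    have "(L powr \<eta>) ^ ?s = (L ^ ?s) powr \<eta>"
      using L0 by (simp add: powr_powr mult.commute flip: powr_realpow)
    also have "\<dots> \<le> (real n ^ 2) powr \<eta>"
    proof (rule powr_mono2)
      have "totient r \<le> n" using tot[OF r] assms(5) by linarith
      then show "L ^ ?s \<le> real n ^ 2"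
        unfolding L_def using assms(3) r0 by (intro ln_power_card_prime_factors_le) auto
    qed (use L0 assms(6) in auto)
    also have "real n ^ 2 = real n powr 2" using assms(3) by simp
    also have "(real n powr 2) powr \<eta> = real n powr (2 * \<eta>)" by (rule powr_powr)
    finally have 1: "(\<Prod>q\<in>prime_factors r. 2 * L / ln (real q)) \<le> real n powr (2 * \<eta>) * ?B"
      unfolding eq using B0 by (rule mult_right_mono)
    have "1 \<le> Y * (1 / real (totient r))" using tot[OF r] r0 by (simp add: field_simps)
    then have 2: "?B * 1 \<le> ?B * (Y * (1 / real (totient r)))" using B0 by (intro mult_left_mono)
    have "1 / real (totient r) = (\<Prod>q\<in>prime_factors r. 1 / real (q ^ (multiplicity q r - 1) * (q - 1)))"
      unfolding totient_formula1[OF r0] of_nat_prod by (simp add: prod_dividef)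
    then have "?B * (1 / real (totient r)) = (\<Prod>q\<in>prime_factors r. u q (multiplicity q r))"
      unfolding u_def by (simp only: prod.distrib)
    then have "?B * (Y * (1 / real (totient r))) = Y * (\<Prod>q\<in>prime_factors r. u q (multiplicity q r))"
      by (metis mult.left_commute)
    with 2 have "?B \<le> Y * (\<Prod>q\<in>prime_factors r. u q (multiplicity q r))" by simp
    then have "real n powr (2 * \<eta>) * ?B \<le> real n powr (2 * \<eta>) * (Y * (\<Prod>q\<in>prime_factors r. u q (multiplicity q r)))"
      by (intro mult_left_mono) auto
    with 1 show ?thesis by (simp add: mult.assoc)
  qed
  have "(\<Sum>r\<in>R. \<Prod>q\<in>prime_factors r. 2 * L / ln (real q))
    \<le> real n powr (2 * \<eta>) * Y * (\<Sum>r\<in>R. \<Prod>q\<in>prime_factors r. u q (multiplicity q r))"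
    unfolding sum_distrib_left using term_le by (rule sum_mono)
  also have "\<dots> \<le> real n powr (2 * \<eta>) * Y * exp (8 * L powr (1 - \<eta>) * (ln L + 2))"
  proof -
    have "(\<Sum>r\<in>R. \<Prod>q\<in>prime_factors r. u q (multiplicity q r)) \<le> exp (\<Sum>q | prime q \<and> q \<le> n. A / ln (real q) * (4 / real q))"
    proof (rule sum_over_prime_factorizations_le[OF assms(1,2) R u0])
      fix q E :: nat assume q: "prime q"
      show "(\<Sum>e=1..E. u q e) \<le> A / ln (real q) * (4 / real q)"
        unfolding u_def sum_distrib_left[symmetric]
        using sum_inverse_totient_prime_power_le[OF q, of E] lnq[OF q] A0
        by (intro mult_left_mono) auto
    qed
    also have "\<dots> \<le> exp (8 * L powr (1 - \<eta>) * (ln L + 2))"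
    proof -
      have "(\<Sum>q | prime q \<and> q \<le> n. A / ln (real q) * (4 / real q)) \<le> (\<Sum>q=2..n. A / ln (real q) * (4 / real q))"
        using A0 by (intro sum_mono2) (auto dest: prime_ge_2_nat)
      also have "\<dots> = 4 * A * (\<Sum>q=2..n. 1 / (real q * ln (real q)))"
        unfolding sum_distrib_left by (intro sum.cong refl) (simp add: field_simps)
      also have "\<dots> \<le> 4 * A * (ln L + 2)"
        unfolding L_def using sum_inverse_mult_ln_le[of n] A0 assms(3) by (intro mult_left_mono) auto
      finally show ?thesis by (simp add: A_def)
    qed
    finally show ?thesis using assms(4) by (intro mult_left_mono) auto
  qed
  finally show ?thesis .
qed

section \<open>Counting the primes dividing the orders\<close>

lemma prime_factor_minus_1_le_totient:
  assumes "r > 0" "q \<in> prime_factors r"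
  shows "q - 1 \<le> totient r"
proof -
  have "prime q" "q dvd r" using assms(2) by (auto simp: in_prime_factors_iff)
  then have "q - 1 dvd totient r" using totient_dvd totient_prime by metis
  then show ?thesis using assms(1) by (intro dvd_imp_le) auto
qed

text \<open>For \<open>s\<close> prime factors, \<open>2 ^ s <= fact s * exp 2 <= n * exp 2\<close>.
  Hence \<open>s * ln 2 <= ln n + 2 <= 3 * ln n\<close>, and \<open>ln 2 >= 2 / 3\<close> leaves
  room below the constant 5.\<close>

lemma card_prime_factors_le_ln:
  assumes "d > 0" "totient d \<le> n" "ln (real n) \<ge> 1"
  shows "card (prime_factors d) \<le> 5 * ln (real n)"
proof -
  let ?s = "card (prime_factors d)"
  have n: "real n > 0" using assms(3) by (cases n) auto
  have "fact ?s \<le> n" using fact_card_prime_factors_le_totient[OF assms(1)] assms(2) by (rule le_trans)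
  then have f: "fact ?s \<le> real n" by (metis of_nat_fact of_nat_le_iff)
  have "2 ^ ?s \<le> fact ?s * exp (2::real)" by (rule power_le_fact_exp) simp
  also have "\<dots> \<le> real n * exp 2" using f by (intro mult_right_mono) auto
  also have "\<dots> = exp (ln (real n) + 2)" using n by (simp add: exp_add)
  finally have "ln ((2::real) ^ ?s) \<le> ln (exp (ln (real n) + 2))" by (subst ln_le_cancel_iff) auto
  then have "?s * ln 2 \<le> ln (real n) + 2" by (simp add: ln_realpow)
  moreover have "?s * (2 / 3) \<le> ?s * ln (2::real)"
    by (intro mult_left_mono ln2_ge_two_thirds) simp
  ultimately show ?thesis using assms(3) by linarith
qed

context bounded_norm_poly
begin

definition P :: "nat set" where
  "P = {p. prime p \<and> (\<exists>d\<in>D. p dvd d)}"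

lemma D_pos: "d \<in> D \<Longrightarrow> d > 0"
  by (simp add: D_def)

lemma finite_P: "finite P"
proof -
  have "P \<subseteq> (\<Union>d\<in>D. prime_factors d)" using D_pos by (auto simp: P_def in_prime_factors_iff)
  then show ?thesis by (rule finite_subset) (simp add: finite_D)
qed

text \<open>A prime \<open>p > Y + 1\<close> that divides an order \<open>d\<close> with \<open>totient d < Y ^ 2\<close> has a cofactor
  \<open>r\<close> with \<open>totient r \<le> Y\<close>; since \<open>\<Sum>d. totient d \<le> n = Y ^ 3\<close>, at most \<open>Y\<close> orders \<open>d\<close> have
  \<open>totient d \<ge> Y ^ 2\<close>. This is where the exponent \<open>1 / 3\<close> comes from.\<close>

lemma card_P_le:
  fixes \<eta> :: real
  assumes "\<eta> > 0"
  defines "L \<equiv> ln (real n)" and "Y \<equiv> real n powr (1 / 3)"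
  shows "card P \<le> Y + 1 + 5 * Y * L
    + C * L / ln 2 * (real n powr (2 * \<eta>) * Y * exp (8 * L powr (1 - \<eta>) * (ln L + 2)))"
proof -
  have L1: "L \<ge> 1" using ln_n_ge_1 by (simp add: L_def)
  have Y0: "Y > 0" using n_ge_3 by (simp add: Y_def)
  have Y3: "Y * Y ^ 2 = real n"
  proof -
    have "Y * Y ^ 2 = Y ^ 3" by (simp add: power3_eq_cube power2_eq_square)
    also have "\<dots> = real n" using n_ge_3 by (simp add: Y_def powr_power)
    finally show ?thesis .
  qed
  have Yn: "Y < real n" using n_ge_3 powr_less_mono[of "1 / 3" 1 "real n"] by (simp add: Y_def)
  define D2 where "D2 = {d \<in> D. real (totient d) \<ge> Y ^ 2}"
  \<comment> \<open>\<open>R\<close> contains the small cofactors left when the full power of a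
    prime is removed from an order; for each of them \<open>card_primes_le\<close> bounds the set
    \<open>S r\<close> of primes that complete it.\<close>
  define R where "R = {r. r > 0 \<and> real (totient r) \<le> Y \<and> (\<exists>p i. i > 0 \<and> r * p ^ i \<in> D)}"
  define S where "S = (\<lambda>r. {p. prime p \<and> \<not> p dvd r \<and> (\<exists>i>0. r * p ^ i \<in> D)})"
  have fin2: "finite D2" using finite_D by (simp add: D2_def)
  have finR: "finite R"
  proof (rule finite_subset)
    show "R \<subseteq> (\<Union>d\<in>D. {r. r dvd d})"
    proof
      fix r assume "r \<in> R"
      then obtain p i where "r * p ^ i \<in> D" by (auto simp: R_def)
      then show "r \<in> (\<Union>d\<in>D. {r. r dvd d})" by (intro UN_I) auto
    qed
    show "finite (\<Union>d\<in>D. {r. r dvd d})" using finite_D D_pos by (intro finite_UN_I finite_divisors_nat) auto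
  qed
  have finS: "finite (S r)" for r
  proof (rule finite_subset[OF _ finite_P])
    show "S r \<subseteq> P"
    proof
      fix p assume "p \<in> S r"
      then obtain i where i: "prime p" "i > 0" "r * p ^ i \<in> D" by (auto simp: S_def)
      then have "p dvd r * p ^ i" by simp
      with i show "p \<in> P" unfolding P_def by blast
    qed
  qed
  have cover: "P \<subseteq> {1..nat \<lfloor>Y + 1\<rfloor>} \<union> (\<Union>d\<in>D2. prime_factors d) \<union> (\<Union>r\<in>R. S r)"
  proof
    fix p assume "p \<in> P"
    then obtain d where p: "prime p" and d: "d \<in> D" "p dvd d" by (auto simp: P_def)
    have p1: "p > 1" using p by (rule prime_gt_1_nat)
    show "p \<in> {1..nat \<lfloor>Y + 1\<rfloor>} \<union> (\<Union>d\<in>D2. prime_factors d) \<union> (\<Union>r\<in>R. S r)"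
    proof (cases "real p \<le> Y + 1")
      case True
      then have "p \<le> nat \<lfloor>Y + 1\<rfloor>" by (rule le_nat_floor)
      then show ?thesis using p1 by simp
    next
      case False
      show ?thesis
      proof (cases "d \<in> D2")
        case True
        then show ?thesis using p d D_pos[OF d(1)] by (auto simp: in_prime_factors_iff)
      next
        case d2: False
        have "\<not> is_unit p" using p not_prime_unit by blast
        then obtain r where r: "d = p ^ multiplicity p d * r" "\<not> p dvd r"
          using multiplicity_decompose'[of d p] D_pos[OF d(1)] by auto
        define i where "i = multiplicity p d"
        have i: "i > 0" using p d D_pos[OF d(1)] by (simp add: i_def prime_multiplicity_gt_zero_iff)
        have dr: "d = r * p ^ i" using r(1) by (simp add: i_def mult.commute)
        have r0: "r > 0" using dr D_pos[OF d(1)] by (cases r) auto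
        have cop: "coprime r (p ^ i)" using prime_imp_coprime[OF p r(2)] by (simp add: coprime_commute)
        have "p ^ (i - 1) \<ge> 1" using p1 by simp
        then have "totient (p ^ i) \<ge> p - 1" using p i by (simp add: totient_prime_power)
        then have "totient d \<ge> totient r * (p - 1)"
          unfolding dr totient_mult_coprime[OF cop] by (rule mult_le_mono2)
        then have "real (totient r) * real (p - 1) \<le> real (totient d)"
          by (metis of_nat_le_iff of_nat_mult)
        also have "\<dots> < Y ^ 2" using d2 d(1) by (simp add: D2_def)
        also have "Y ^ 2 = Y * Y" by (rule power2_eq_square)
        also have "\<dots> \<le> Y * real (p - 1)"
          using False p1 Y0 by (intro mult_left_mono) (auto simp: of_nat_diff)
        finally have "real (totient r) < Y" using p1 by simp
        then have "r \<in> R" using r0 i d(1) dr by (auto simp: R_def)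
        moreover have "p \<in> S r" using p r(2) i d(1) dr by (auto simp: S_def)
        ultimately show ?thesis by blast
      qed
    qed
  qed
  have "card P \<le> card ({1..nat \<lfloor>Y + 1\<rfloor>} \<union> (\<Union>d\<in>D2. prime_factors d) \<union> (\<Union>r\<in>R. S r))"
    using fin2 finR finS by (intro card_mono[OF _ cover]) simp
  also have "\<dots> \<le> card {1..nat \<lfloor>Y + 1\<rfloor>} + card (\<Union>d\<in>D2. prime_factors d) + card (\<Union>r\<in>R. S r)"
    by (rule order_trans[OF card_Un_le add_right_mono[OF card_Un_le]])
  also have "\<dots> \<le> nat \<lfloor>Y + 1\<rfloor> + (\<Sum>d\<in>D2. card (prime_factors d)) + (\<Sum>r\<in>R. card (S r))"
    using card_UN_le[OF fin2] card_UN_le[OF finR] by (intro add_mono) auto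
  finally have "real (card P) \<le> real (nat \<lfloor>Y + 1\<rfloor> + (\<Sum>d\<in>D2. card (prime_factors d)) + (\<Sum>r\<in>R. card (S r)))"
    by (simp only: of_nat_le_iff)
  then have "real (card P) \<le> real (nat \<lfloor>Y + 1\<rfloor>) + (\<Sum>d\<in>D2. real (card (prime_factors d))) + (\<Sum>r\<in>R. real (card (S r)))"
    by (simp only: of_nat_add of_nat_sum)
  moreover have "real (nat \<lfloor>Y + 1\<rfloor>) \<le> Y + 1" using Y0 by (intro of_nat_floor) simp
  moreover have "(\<Sum>d\<in>D2. real (card (prime_factors d))) \<le> 5 * Y * L"
  proof -
    have "real (card D2) * Y ^ 2 = (\<Sum>d\<in>D2. Y ^ 2)" by simp
    also have "\<dots> \<le> (\<Sum>d\<in>D2. real (totient d))" by (rule sum_mono) (simp add: D2_def)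
    also have "\<dots> = real (\<Sum>d\<in>D2. totient d)" by simp
    also have "\<dots> \<le> Y * Y ^ 2" unfolding Y3 of_nat_le_iff by (rule sum_totient_le[OF fin2]) (auto simp: D2_def)
    finally have D2: "real (card D2) \<le> Y" using Y0 by simp
    have "(\<Sum>d\<in>D2. real (card (prime_factors d))) \<le> (\<Sum>d\<in>D2. 5 * L)"
      unfolding L_def using card_prime_factors_le_ln totient_le_n D_pos ln_n_ge_1
      by (intro sum_mono) (auto simp: D2_def)
    also have "\<dots> = real (card D2) * (5 * L)" by simp
    also have "\<dots> \<le> Y * (5 * L)" using D2 L1 by (intro mult_right_mono) auto
    finally show ?thesis by simp
  qed
  moreover have "(\<Sum>r\<in>R. real (card (S r)))
    \<le> C * L / ln 2 * (real n powr (2 * \<eta>) * Y * exp (8 * L powr (1 - \<eta>) * (ln L + 2)))"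
  proof -
    \<comment> \<open>The loss of 1 in \<open>q - 1 <= totient r\<close> is made up by the strict
      inequality \<open>Y < n\<close>.\<close>
    have q_le: "q \<le> n" if "r \<in> R" "q \<in> prime_factors r" for r q
    proof -
      have "q - 1 \<le> totient r" using prime_factor_minus_1_le_totient that by (simp add: R_def)
      then have "real (q - 1) \<le> Y" using that(1) by (simp add: R_def)
      then show ?thesis using Yn by linarith
    qed
    have "real (card (S r)) \<le> C * L / ln 2 * (\<Prod>q\<in>prime_factors r. 2 * L / ln (real q))"
      if r: "r \<in> R" for r
    proof -
      have r0: "r > 0" using r by (simp add: R_def)
      have "real (card (S r)) * ln 2 \<le> (mu r + C) * L"
        unfolding L_def by (rule card_primes_le[OF r0 finS]) (auto simp: S_def)
      also have "\<dots> \<le> C * (\<Prod>q\<in>prime_factors r. 2 * L / ln (real q)) * L"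
        unfolding L_def using mu_le_prod[OF r0 q_le[OF r]] ln_n_ge_1 by (intro mult_right_mono) auto
      finally show ?thesis by (simp add: field_simps)
    qed
    then have "(\<Sum>r\<in>R. real (card (S r))) \<le> (\<Sum>r\<in>R. C * L / ln 2 * (\<Prod>q\<in>prime_factors r. 2 * L / ln (real q)))"
      by (rule sum_mono)
    also have "\<dots> = C * L / ln 2 * (\<Sum>r\<in>R. \<Prod>q\<in>prime_factors r. 2 * L / ln (real q))"
      by (rule sum_distrib_left[symmetric])
    also have "\<dots> \<le> C * L / ln 2 * (real n powr (2 * \<eta>) * Y * exp (8 * L powr (1 - \<eta>) * (ln L + 2)))"
      unfolding L_def
      by (intro mult_left_mono sum_prod_prime_factors_le)
        (use finR n_ge_3 Y0 Yn assms(1) q_le C_pos ln_n_ge_1 in \<open>auto simp: R_def\<close>)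
    finally show ?thesis .
  qed
  ultimately show ?thesis by linarith
qed

text \<open>\<open>K\<close> is the least common multiple of \<open>D\<close>. Its exact power of a
  prime \<open>p\<close> divides some order \<open>d\<close>, so the totient of that power is at
  most \<open>totient d <= n\<close>; since \<open>p <= 2 * (p - 1)\<close>, the power itself is at
  most \<open>2 * n\<close>.\<close>

lemma common_multiple_D:
  obtains K where "K > 0" "\<And>d. d \<in> D \<Longrightarrow> d dvd K" "ln (real K) \<le> card P * ln (2 * real n)"
proof -
  define e where "e = (\<lambda>p. Max ((\<lambda>d. multiplicity p d) ` D))"
  define K where "K = (\<Prod>p\<in>P. p ^ e p)"
  have P_pos: "p > 0" if "p \<in> P" for p using that by (simp add: P_def prime_gt_0_nat)
  have K0: "K > 0" unfolding K_def using P_pos by (intro prod_pos) simp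
  moreover have "d dvd K" if d: "d \<in> D" for d
  proof -
    have sub: "prime_factors d \<subseteq> P" using d by (auto simp: P_def in_prime_factors_iff)
    have "d = (\<Prod>p\<in>prime_factors d. p ^ multiplicity p d)" using D_pos[OF d] by (rule prime_factorization_nat)
    also have "\<dots> dvd (\<Prod>p\<in>prime_factors d. p ^ e p)"
      using d finite_D unfolding e_def by (intro prod_dvd_prod le_imp_power_dvd Max_ge) auto
    also have "\<dots> dvd K" unfolding K_def by (rule prod_dvd_prod_subset[OF finite_P sub])
    finally show ?thesis .
  qed
  moreover have "ln (real K) \<le> card P * ln (2 * real n)"
  proof -
    have pe: "real (p ^ e p) \<le> 2 * real n" if p: "p \<in> P" for p
    proof (cases "e p = 0")
      case True
      then show ?thesis using n_ge_3 by simp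
    next
      case False
      have pr: "prime p" and ne: "D \<noteq> {}" using p by (auto simp: P_def)
      have "e p \<in> (\<lambda>d. multiplicity p d) ` D" unfolding e_def using finite_D ne by (intro Max_in) auto
      then obtain d where d: "d \<in> D" "e p = multiplicity p d" by auto
      then have "totient (p ^ e p) dvd totient d" by (simp add: totient_dvd multiplicity_dvd)
      then have "totient (p ^ e p) \<le> totient d" using D_pos[OF d(1)] by (intro dvd_imp_le) auto
      then have le: "totient (p ^ e p) \<le> n" using totient_le_n[OF d(1)] by linarith
      have "p \<ge> 2" using pr by (rule prime_ge_2_nat)
      then have "p ^ (e p - 1) * p \<le> p ^ (e p - 1) * (2 * (p - 1))" by (intro mult_le_mono2) linarith
      also have "\<dots> = 2 * totient (p ^ e p)" using pr False by (simp add: totient_prime_power)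
      also have "p ^ (e p - 1) * p = p ^ e p" using False power_minus_mult[of "e p" p] by simp
      finally have "p ^ e p \<le> 2 * n" using le by linarith
      then show ?thesis by (metis of_nat_le_iff of_nat_mult of_nat_numeral)
    qed
    have "ln (real K) = (\<Sum>p\<in>P. ln (real (p ^ e p)))"
      unfolding K_def of_nat_prod using P_pos finite_P by (subst ln_prod) auto
    also have "\<dots> \<le> (\<Sum>p\<in>P. ln (2 * real n))"
    proof (rule sum_mono)
      fix p assume p: "p \<in> P"
      have "real (p ^ e p) > 0" using P_pos[OF p] by simp
      then show "ln (real (p ^ e p)) \<le> ln (2 * real n)" using pe[OF p] n_ge_3 by (subst ln_le_cancel_iff) auto
    qed
    finally show ?thesis by simp
  qed
  ultimately show ?thesis by (rule that)
qed

end

text \<open>A divisor of a nonzero multiple of \<open>x_pow_minus_1 k\<close> has only simple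
  complex roots, so \<open>degree q\<close> counts them. The pseudo-remainder of
  \<open>x_pow_minus_1 K\<close> by \<open>q\<close> vanishes at all of them but has smaller degree,
  hence is zero; the pseudo-division multiplier serves as the integer.\<close>

lemma dvd_multiple_of_x_pow_minus_1I:
  assumes "dvd_multiple_of_x_pow_minus_1 q k" "k > 0"
    and K: "\<And>w. ipoly q w = 0 \<Longrightarrow> w ^ K = 1"
  shows "dvd_multiple_of_x_pow_minus_1 q K"
proof -
  obtain l where l: "l \<noteq> 0" "q dvd smult l (x_pow_minus_1 k)"
    using assms(1) by (auto simp: dvd_multiple_of_x_pow_minus_1_def)
  then obtain g where g: "smult l (x_pow_minus_1 k) = q * g" by (elim dvdE)
  have q0: "q \<noteq> 0" using l g x_pow_minus_1_nonzero[OF assms(2)] by auto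
  have g': "smult (of_int l) (cpoly (x_pow_minus_1 k)) = cpoly q * cpoly g"
    using arg_cong[OF g, of cpoly] by simp
  have "rsquarefree (cpoly q)"
    unfolding rsquarefree_roots
  proof (intro allI notI, elim conjE)
    fix w assume w: "ipoly q w = 0" "poly (pderiv (cpoly q)) w = 0"
    have "of_int l * ipoly (x_pow_minus_1 k) w = 0"
      using arg_cong[OF g', of "\<lambda>p. poly p w"] w by simp
    then have "w ^ k = 1" using l by simp
    then have "w \<noteq> 0" using assms(2) by (auto simp: power_0_left)
    have "of_int l * ipoly (pderiv (x_pow_minus_1 k)) w = 0"
      using arg_cong[OF g', of "\<lambda>p. poly (pderiv p) w"] w by (simp add: pderiv_smult pderiv_mult)
    then have "of_nat k * w ^ (k - 1) = 0"
      using l by (simp add: pderiv_x_pow_minus_1 poly_monom del: cpoly_pderiv)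
    then show False using \<open>w \<noteq> 0\<close> assms(2) by simp
  qed
  from complex_poly_decompose_rsquarefree[OF this]
  have "degree (cpoly q) = degree (smult (of_int (lead_coeff q)) (\<Prod>z | ipoly q z = 0. [:-z, 1:]))"
    by simp
  also have "\<dots> = (\<Sum>z | ipoly q z = 0. degree [:-z, 1:])"
    using q0 by (subst degree_smult_eq, subst degree_prod_eq_sum_degree) auto
  finally have deg: "degree q = card {z. ipoly q z = 0}" by simp
  obtain s R where sR: "pseudo_divmod (x_pow_minus_1 K) q = (s, R)" by fastforce
  define l' where "l' = coeff q (degree q) ^ (Suc (degree (x_pow_minus_1 K)) - degree q)"
  have l': "l' \<noteq> 0" using q0 by (simp add: l'_def)
  have eq: "smult l' (x_pow_minus_1 K) = q * s + R" and degR: "R = 0 \<or> degree R < degree q"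
    using pseudo_divmod[OF q0 sR] by (auto simp: l'_def)
  have "R = 0"
  proof (rule ccontr)
    assume R0: "R \<noteq> 0"
    have "{z. ipoly q z = 0} \<subseteq> {z. ipoly R z = 0}"
    proof
      fix z assume z: "z \<in> {z. ipoly q z = 0}"
      then show "z \<in> {z. ipoly R z = 0}"
        using arg_cong[OF eq, of "\<lambda>p. ipoly p z"] K[of z] by simp
    qed
    then have "card {z. ipoly q z = 0} \<le> card {z. ipoly R z = 0}"
      using R0 by (intro card_mono poly_roots_finite) auto
    also have "\<dots> \<le> degree (cpoly R)" using R0 by (intro card_poly_roots_bound) simp
    finally show False using deg degR R0 by simp
  qed
  then have "q dvd smult l' (x_pow_minus_1 K)" using eq by simp
  then show ?thesis using l' by (auto simp: dvd_multiple_of_x_pow_minus_1_def)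
qed

text \<open>The argument of \<open>exp\<close> is of smaller order than \<open>ln x\<close>, so that
  factor is eventually at most \<open>x powr \<eta>\<close>. The main term then has exponent
  \<open>1 / 3 + 3 * \<eta>\<close> up to logarithms, which a further \<open>\<eta>\<close>
  absorbs.\<close>

lemma eventually_final_bound:
  fixes \<epsilon> \<eta> C :: real
  assumes "0 < \<eta>" "\<eta> < 1" "4 * \<eta> \<le> \<epsilon>" "0 < C"
  shows "eventually (\<lambda>x. ln x + (x powr (1 / 3) + 1 + 5 * x powr (1 / 3) * ln x
      + C * ln x / ln 2 * (x powr (2 * \<eta>) * x powr (1 / 3) * exp (8 * ln x powr (1 - \<eta>) * (ln (ln x) + 2)))) * ln (2 * x)
    \<le> x powr (1 / 3 + \<epsilon>)) at_top"
proof -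
  have "eventually (\<lambda>x. 8 * ln x powr (1 - \<eta>) * (ln (ln x) + 2) \<le> \<eta> * ln x) at_top"
    using assms by real_asymp
  moreover have "eventually (\<lambda>x. ln x + (x powr (1 / 3) + 1 + 5 * x powr (1 / 3) * ln x
      + C * ln x / ln 2 * (x powr (2 * \<eta>) * x powr (1 / 3) * x powr \<eta>)) * ln (2 * x)
    \<le> x powr (1 / 3 + 4 * \<eta>)) at_top"
    using assms by real_asymp
  moreover have "eventually (\<lambda>x. x \<ge> (1::real)) at_top" by (rule eventually_ge_at_top)
  ultimately show ?thesis
  proof eventually_elim
    case (elim x)
    have "exp (8 * ln x powr (1 - \<eta>) * (ln (ln x) + 2)) \<le> exp (\<eta> * ln x)" using elim(1) by simp
    also have "\<dots> = x powr \<eta>" using elim(3) by (simp add: powr_def)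
    finally have e: "exp (8 * ln x powr (1 - \<eta>) * (ln (ln x) + 2)) \<le> x powr \<eta>" .
    have "ln x + (x powr (1 / 3) + 1 + 5 * x powr (1 / 3) * ln x
      + C * ln x / ln 2 * (x powr (2 * \<eta>) * x powr (1 / 3) * exp (8 * ln x powr (1 - \<eta>) * (ln (ln x) + 2)))) * ln (2 * x)
      \<le> ln x + (x powr (1 / 3) + 1 + 5 * x powr (1 / 3) * ln x
      + C * ln x / ln 2 * (x powr (2 * \<eta>) * x powr (1 / 3) * x powr \<eta>)) * ln (2 * x)"
      using e elim(3) assms by (intro add_left_mono mult_right_mono mult_left_mono) auto
    also have "\<dots> \<le> x powr (1 / 3 + 4 * \<eta>)" by (rule elim(2))
    also have "\<dots> \<le> x powr (1 / 3 + \<epsilon>)" using elim(3) assms by (intro powr_mono) auto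
    finally show ?case .
  qed
qed

theorem theorem8:
  fixes c :: real
  assumes "c < 100 * ln 2 - 2"
  shows "\<forall>\<epsilon>::real. \<epsilon> > 0 \<longrightarrow>
    (\<exists>n0::int. \<forall>(q::int poly) (f::int poly) (m::nat) (n::nat).
       poly f 1 \<noteq> 0 \<longrightarrow> m > 0 \<longrightarrow>
       q dvd x_pow_minus_1 m * f \<longrightarrow>
       n = degree (x_pow_minus_1 m * f) \<longrightarrow> int n \<ge> n0 \<longrightarrow>
       real_of_int (poly_norm f) \<le> real n powr c \<longrightarrow>
       (\<exists>k>0. dvd_multiple_of_x_pow_minus_1 q k) \<longrightarrow>
       ln (real (LEAST k. k > 0 \<and> dvd_multiple_of_x_pow_minus_1 q k))
         \<le> real n powr (1 / 3 + \<epsilon>))"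
proof (intro allI impI)
  fix \<epsilon> :: real
  assume "\<epsilon> > 0"
  \<comment> \<open>A quarter of \<open>\<epsilon>\<close> for the four losses of
    \<open>\<eta>\<close> in the final estimate; the cap keeps \<open>1 - \<eta>\<close>
    positive.\<close>
  define \<eta> where "\<eta> = min \<epsilon> 1 / 4"
  have \<eta>: "0 < \<eta>" "\<eta> < 1" "4 * \<eta> \<le> \<epsilon>" using \<open>\<epsilon> > 0\<close> by (auto simp: \<eta>_def)
  define C where "C = max c 1"
  have C: "C > 0" by (simp add: C_def)
  obtain x0 where x0: "\<And>x. x \<ge> x0 \<Longrightarrow> ln x + (x powr (1 / 3) + 1 + 5 * x powr (1 / 3) * ln x
      + C * ln x / ln 2 * (x powr (2 * \<eta>) * x powr (1 / 3) * exp (8 * ln x powr (1 - \<eta>) * (ln (ln x) + 2)))) * ln (2 * x)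
    \<le> x powr (1 / 3 + \<epsilon>)"
    using eventually_final_bound[OF \<eta> C] unfolding eventually_at_top_linorder by blast
  show "\<exists>n0::int. \<forall>(q::int poly) (f::int poly) (m::nat) (n::nat).
       poly f 1 \<noteq> 0 \<longrightarrow> m > 0 \<longrightarrow>
       q dvd x_pow_minus_1 m * f \<longrightarrow>
       n = degree (x_pow_minus_1 m * f) \<longrightarrow> int n \<ge> n0 \<longrightarrow>
       real_of_int (poly_norm f) \<le> real n powr c \<longrightarrow>
       (\<exists>k>0. dvd_multiple_of_x_pow_minus_1 q k) \<longrightarrow>
       ln (real (LEAST k. k > 0 \<and> dvd_multiple_of_x_pow_minus_1 q k))
         \<le> real n powr (1 / 3 + \<epsilon>)"
  proof (intro exI[of _ "max 3 \<lceil>x0\<rceil>"] allI impI)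
    fix q f :: "int poly" and m n :: nat
    assume f1: "poly f 1 \<noteq> 0" and m: "m > 0" and q: "q dvd x_pow_minus_1 m * f"
      and n: "n = degree (x_pow_minus_1 m * f)" and n0: "int n \<ge> max 3 \<lceil>x0\<rceil>"
      and norm: "real_of_int (poly_norm f) \<le> real n powr c"
      and ex: "\<exists>k>0. dvd_multiple_of_x_pow_minus_1 q k"
    have n3: "n \<ge> 3" and nx: "real n \<ge> x0" using n0 by (simp, linarith)
    have "f \<noteq> 0" using f1 by auto
    then have nm: "n = m + degree f"
      unfolding n using x_pow_minus_1_nonzero[OF m] by (simp add: degree_mult_eq degree_x_pow_minus_1)
    have "real n powr c \<le> real n powr C" using n3 by (intro powr_mono) (auto simp: C_def)
    then interpret bounded_norm_poly f n C
      using f1 nm norm n3 C by unfold_locales linarith+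
    obtain K where K: "K > 0" "\<And>d. d \<in> D \<Longrightarrow> d dvd K" "ln (real K) \<le> card P * ln (2 * real n)"
      using common_multiple_D by blast
    obtain k where k: "k > 0" "dvd_multiple_of_x_pow_minus_1 q k" using ex by blast
    \<comment> \<open>The factor \<open>m\<close> serves the roots of \<open>q\<close> coming from
      \<open>x_pow_minus_1 m\<close>, and \<open>K\<close> those coming from
      \<open>f\<close>.\<close>
    have "dvd_multiple_of_x_pow_minus_1 q (m * K)"
    proof (rule dvd_multiple_of_x_pow_minus_1I[OF k(2,1)])
      fix w assume w: "ipoly q w = 0"
      obtain l g where l: "l \<noteq> 0" "smult l (x_pow_minus_1 k) = q * g"
        using k(2) unfolding dvd_multiple_of_x_pow_minus_1_def dvd_def by blast
      have "of_int l * (w ^ k - 1) = 0"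
        using arg_cong[OF l(2), of "\<lambda>p. ipoly p w"] w by simp
      then have "w ^ k = 1" using l(1) by simp
      then obtain d where d: "d > 0" "w \<in> proots d" using root_of_unity_in_proots k(1) by blast
      obtain h where "x_pow_minus_1 m * f = q * h" using q by (elim dvdE)
      from arg_cong[OF this, of "\<lambda>p. ipoly p w"] w
      have "w ^ m = 1 \<or> ipoly f w = 0" by simp
      then have "d dvd m \<or> d \<in> D"
        using prootsD[OF d(2)] ipoly_eq_0_iff_Phi_dvd[OF d] d(1) by (auto simp: D_def)
      then have "d dvd m * K" using K(2) by auto
      then show "w ^ (m * K) = 1" using prootsD[OF d(2)] by blast
    qed
    then have mK: "m * K > 0 \<and> dvd_multiple_of_x_pow_minus_1 q (m * K)" using m K(1) by simp
    let ?k = "LEAST k. k > 0 \<and> dvd_multiple_of_x_pow_minus_1 q k"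
    have "?k \<le> m * K" using mK by (rule Least_le)
    moreover have "?k > 0" using LeastI[of "\<lambda>k. k > 0 \<and> dvd_multiple_of_x_pow_minus_1 q k", OF mK] by blast
    ultimately have "ln (real ?k) \<le> ln (real (m * K))"
      using m K(1) by (subst ln_le_cancel_iff) (auto simp del: of_nat_mult)
    also have "\<dots> = ln (real m) + ln (real K)" using m K(1) by (simp add: ln_mult)
    also have "\<dots> \<le> ln (real n) + card P * ln (2 * real n)"
      using m nm K(3) by (intro add_mono) auto
    also have "\<dots> \<le> ln (real n) + (real n powr (1 / 3) + 1 + 5 * real n powr (1 / 3) * ln (real n)
      + C * ln (real n) / ln 2 * (real n powr (2 * \<eta>) * real n powr (1 / 3)
        * exp (8 * ln (real n) powr (1 - \<eta>) * (ln (ln (real n)) + 2)))) * ln (2 * real n)"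
      using card_P_le[OF \<eta>(1)] n3 by (intro add_left_mono mult_right_mono) auto
    also have "\<dots> \<le> real n powr (1 / 3 + \<epsilon>)" by (rule x0[OF nx])
    finally show "ln (real ?k) \<le> real n powr (1 / 3 + \<epsilon>)" .
  qed
qed

end
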